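(* Let $\alpha\in(0,1)$, let $m, M_0, M_1>0$ and let $0<p\le P$. There exists a constant $K$, depending only on $\alpha$, $m$, $M_1$, $p$ and $P$, such that the following holds. Let $\zeta_o\in\mathbb{C}$ and, for $j=1,2$, let $\Omega_j\subseteq\mathbb{C}$ be a bounded, simply connected open set with boundary of class $C^{1,\alpha}$, with $\zeta_o\in\Omega_j$ and perimeter $L_j$ satisfying $p\le L_j\le P$; let $\zeta_j\in\partial\Omega_j$ and let $f_j\in C^{1,\alpha}(\overline D,\mathbb{C})$ be the one-to-one function, analytic in $D$, with $f_j(D)=\Omega_j$, $f_j(0)=\zeta_o$, $f_j(1)=\zeta_j$. Put $\varphi_j=\mathcal{T}(f_j)$, $L=\frac{L_1+L_2}{2}$ and $$\hat\varphi_j(s)=\varphi_j\left(\frac{L_j}{L}s\right),\quad s\in[0,L]\qquad(j=1,2).$$ If $\varphi_j\in\mathscr{G}_1^{L_j}$ for $j=1,2$, then, up to rotations of the domains around $\zeta_o$ (that is, after replacing $\Omega_1$ by its image under a suitable rotation of the plane about $\zeta_o$), $$d_{H}(\Omega_1,\Omega_2)\le K\left\{\left(\Vert\hat\varphi_1-\hat\varphi_2\Vert_{\infty,[0,L]}+|L_1-L_2|\right)^{\alpha}+\Vert\hat\varphi_2'-\hat\varphi_1'\Vert_{\infty,[0,L]}\right\}.$$ The functions $\hat\varphi_1,\hat\varphi_2$ are those of the original domains.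
   Context: $D$ is the open unit disk in $\mathbb{C}$. Existence and uniqueness of $f_j$ follow from the Riemann mapping theorem and Kellogg's theorem. For $f=f_j$, $\Omega=\Omega_j$, let $u$ be the solution of $-\Delta u=\delta_{\zeta_o}$ in $\Omega$, $u=0$ on $\partial\Omega$. $\mathcal{T}(f)$ denotes the interior normal derivative of $u$ on $\partial\Omega$ as a function of the arclength $s\in[0,|\partial\Omega|]$, measured counterclockwise from $f(1)$, extended $|\partial\Omega|$-periodically to $\mathbb{R}$. Parametrically, $s=\int_0^\theta|f'(e^{it})|\,dt$ and $\mathcal{T}(f)(s)=\frac{1}{2\pi|f'(e^{i\theta})|}$, $\theta\in[0,2\pi]$. For a function $\varphi$ on an interval $I$: $\Vert\varphi\Vert_{\infty,I}=\sup_I|\varphi|$, $[\varphi]_{k,\alpha,I}=\sup_{x\ne y\in I}\frac{|\varphi^{(k)}(x)-\varphi^{(k)}(y)|}{|x-y|^\alpha}$, $\Vert\varphi\Vert_{k,\alpha,I}=\sum_{j=0}^k\Vert\varphi^{(j)}\Vert_{\infty,I}+[\varphi]_{k,\alpha,I}$. For $\ell>0$, $\mathscr{G}_0^{\ell}$ is the set of $\ell$-periodic $\varphi\in C^{0,\alpha}(\mathbb{R})$ with $\varphi\ge m$ and $\Vert\varphi\Vert_{0,\alpha,[0,\ell]}\le M_0$; $\mathscr{G}_1^{\ell}$ is the set of $\varphi\in\mathscr{G}_0^{\ell}\cap C^{1,\alpha}(\mathbb{R})$ with $\Vert\varphi\Vert_{1,\alpha,[0,\ell]}\le M_1$. The Hausdorff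 distance is $d_H(A,B)=\max\{\rho(A,B),\rho(B,A)\}$ with $\rho(A,B)=\sup_{a\in A}\inf_{b\in B}|a-b|$; for bounded open sets it is given by the same formula (equivalently, applied to their closures). *)

theory Defs
  imports "HOL-Complex_Analysis.Complex_Analysis"
begin

section \<open>Hoelder classes and norms\<close>

definition holder_on :: "real \<Rightarrow> 'a::metric_space set \<Rightarrow> ('a \<Rightarrow> 'b::metric_space) \<Rightarrow> bool" where
  "holder_on \<alpha> S f \<longleftrightarrow> (\<exists>C. \<forall>x\<in>S. \<forall>y\<in>S. dist (f x) (f y) \<le> C * dist x y powr \<alpha>)"

text \<open>Used for real functions on an interval, and for maps that are analytic in the unit disc
  with \<open>S\<close> the closed disc. Derivatives are taken within \<open>S\<close>, so they are one-sided on the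
  boundary of \<open>S\<close>.\<close>

definition C1_holder_on :: "real \<Rightarrow> 'a::real_normed_field set \<Rightarrow> ('a \<Rightarrow> 'a) \<Rightarrow> bool" where
  "C1_holder_on \<alpha> S f \<longleftrightarrow>
     (\<exists>f'. (\<forall>x\<in>S. (f has_field_derivative f' x) (at x within S)) \<and> holder_on \<alpha> S f')"

definition sup_norm_on :: "real set \<Rightarrow> (real \<Rightarrow> real) \<Rightarrow> real" where
  "sup_norm_on I \<phi> = (SUP x\<in>I. \<bar>\<phi> x\<bar>)"

definition holder_seminorm :: "nat \<Rightarrow> real \<Rightarrow> real set \<Rightarrow> (real \<Rightarrow> real) \<Rightarrow> real" where
  "holder_seminorm k \<alpha> I \<phi> =
     (SUP (x, y)\<in>{(x, y). x \<in> I \<and> y \<in> I \<and> x \<noteq> y}.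
        \<bar>(deriv ^^ k) \<phi> x - (deriv ^^ k) \<phi> y\<bar> / \<bar>x - y\<bar> powr \<alpha>)"

definition holder_norm :: "nat \<Rightarrow> real \<Rightarrow> real set \<Rightarrow> (real \<Rightarrow> real) \<Rightarrow> real" where
  "holder_norm k \<alpha> I \<phi> =
     (\<Sum>j\<le>k. sup_norm_on I ((deriv ^^ j) \<phi>)) + holder_seminorm k \<alpha> I \<phi>"

text \<open>A periodic function is of class \<open>C\<^sup>0\<^sup>,\<^sup>\<alpha>\<close> or \<open>C\<^sup>1\<^sup>,\<^sup>\<alpha>\<close> locally iff it is so
  uniformly on the real line. Membership is part of the definitions below, so the suprema in
  the norms are suprema of bounded sets.\<close>

definition G0 :: "real \<Rightarrow> real \<Rightarrow> real \<Rightarrow> real \<Rightarrow> (real \<Rightarrow> real) set" where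
  "G0 \<alpha> m M0 l = {\<phi>. (\<forall>s. \<phi> (s + l) = \<phi> s) \<and> holder_on \<alpha> UNIV \<phi> \<and> (\<forall>s. m \<le> \<phi> s)
     \<and> holder_norm 0 \<alpha> {0..l} \<phi> \<le> M0}"

definition G1 :: "real \<Rightarrow> real \<Rightarrow> real \<Rightarrow> real \<Rightarrow> real \<Rightarrow> (real \<Rightarrow> real) set" where
  "G1 \<alpha> m M0 M1 l = {\<phi> \<in> G0 \<alpha> m M0 l. C1_holder_on \<alpha> UNIV \<phi> \<and> holder_norm 1 \<alpha> {0..l} \<phi> \<le> M1}"

section \<open>Domains with Hoelder boundary and interior normal derivatives\<close>

text \<open>In the orthonormal frame with origin \<open>x\<close> and axes \<open>w\<close>, \<open>\<i> * w\<close>, the set \<open>\<Omega>\<close> lies above the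
  graph of \<open>\<gamma>\<close> near \<open>x\<close>.\<close>

definition boundary_chart :: "complex set \<Rightarrow> complex \<Rightarrow> complex \<Rightarrow> real \<Rightarrow> (real \<Rightarrow> real) \<Rightarrow> bool" where
  "boundary_chart \<Omega> x w r \<gamma> \<longleftrightarrow> cmod w = 1 \<and> r > 0 \<and>
     (\<forall>y\<in>ball x r. y \<in> \<Omega> \<longleftrightarrow> \<gamma> (Re (cnj w * (y - x))) < Im (cnj w * (y - x)))"

definition C1_holder_boundary :: "real \<Rightarrow> complex set \<Rightarrow> bool" where
  "C1_holder_boundary \<alpha> \<Omega> \<longleftrightarrow>
     (\<forall>x\<in>frontier \<Omega>. \<exists>w r \<gamma>. boundary_chart \<Omega> x w r \<gamma> \<and> C1_holder_on \<alpha> {-r..r} \<gamma>)"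

definition interior_normal :: "complex set \<Rightarrow> complex \<Rightarrow> complex \<Rightarrow> bool" where
  "interior_normal \<Omega> x \<nu> \<longleftrightarrow> x \<in> frontier \<Omega> \<and>
     (\<exists>w r \<gamma> c. boundary_chart \<Omega> x w r \<gamma> \<and> continuous_on {-r..r} \<gamma> \<and>
        (\<gamma> has_real_derivative c) (at 0) \<and> \<nu> = w * Complex (- c) 1 / of_real (sqrt (1 + c\<^sup>2)))"

definition has_interior_normal_derivative ::
    "(complex \<Rightarrow> real) \<Rightarrow> real \<Rightarrow> complex set \<Rightarrow> complex \<Rightarrow> bool" where
  "has_interior_normal_derivative u d \<Omega> x \<longleftrightarrow>
     (\<exists>\<nu>. interior_normal \<Omega> x \<nu> \<and>
        ((\<lambda>t. (u (x + of_real t * \<nu>) - u x) / t) \<longlongrightarrow> d) (at_right 0))"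

section \<open>The Dirichlet problem with a point source\<close>

definition harmonic_on :: "complex set \<Rightarrow> (complex \<Rightarrow> real) \<Rightarrow> bool" where
  "harmonic_on S u \<longleftrightarrow>
     (\<exists>ux uy uxx uxy uyx uyy.
        (\<forall>z\<in>S. (u has_derivative (\<lambda>h. ux z * Re h + uy z * Im h)) (at z) \<and>
               (ux has_derivative (\<lambda>h. uxx z * Re h + uxy z * Im h)) (at z) \<and>
               (uy has_derivative (\<lambda>h. uyx z * Re h + uyy z * Im h)) (at z) \<and>
               uxx z + uyy z = 0) \<and>
        continuous_on S uxx \<and> continuous_on S uxy \<and> continuous_on S uyx \<and> continuous_on S uyy)"

text \<open>The solution \<open>u\<close> of \<open>-\<Delta>u = \<delta>\<^sub>\<zeta>\<close> in \<open>\<Omega>\<close>, \<open>u = 0\<close> on the boundary, i.e. the Green function with pole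
  \<open>\<zeta>\<close>: since \<open>-log|z - \<zeta>|/2\<pi>\<close> is the fundamental solution of \<open>-\<Delta>\<close> in the plane, the equation
  says that \<open>u\<close> is this function plus a harmonic function in \<open>\<Omega>\<close>.\<close>

definition point_source_solution :: "complex set \<Rightarrow> complex \<Rightarrow> (complex \<Rightarrow> real) \<Rightarrow> bool" where
  "point_source_solution \<Omega> \<zeta> u \<longleftrightarrow>
     (\<exists>h. harmonic_on \<Omega> h \<and> (\<forall>z\<in>\<Omega> - {\<zeta>}. u z = - ln (cmod (z - \<zeta>)) / (2 * pi) + h z)) \<and>
     continuous_on (closure \<Omega> - {\<zeta>}) u \<and> (\<forall>z\<in>frontier \<Omega>. u z = 0)"

section \<open>The operator T\<close>

text \<open>The derivative of \<open>f\<close> on the closed disc; on the unit circle it is taken within the closed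
  disc.\<close>

definition disc_deriv :: "(complex \<Rightarrow> complex) \<Rightarrow> complex \<Rightarrow> complex" where
  "disc_deriv f z = (THE d. (f has_field_derivative d) (at z within cball 0 1))"

definition arclength :: "(complex \<Rightarrow> complex) \<Rightarrow> real \<Rightarrow> real" where
  "arclength f \<theta> = integral {0..\<theta>} (\<lambda>t. cmod (disc_deriv f (cis t)))"

definition perimeter :: "(complex \<Rightarrow> complex) \<Rightarrow> real" where
  "perimeter f = arclength f (2 * pi)"

text \<open>\<open>is_T f \<phi>\<close> means \<open>\<T>(f) = \<phi>\<close>: with \<open>\<Omega> = f(D)\<close> and pole \<open>f(0)\<close>, \<open>\<phi>\<close> is the interior normal
  derivative of \<open>u\<close> as a function of the arclength measured counterclockwise from \<open>f(1)\<close>, extended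
  periodically. (A conformal map traverses the boundary counterclockwise as \<open>\<theta>\<close> increases.)
  It is a relation because \<open>u\<close> and its normal derivative are obtained from existence
  theorems; both are unique.\<close>

definition is_T :: "(complex \<Rightarrow> complex) \<Rightarrow> (real \<Rightarrow> real) \<Rightarrow> bool" where
  "is_T f \<phi> \<longleftrightarrow>
     (\<exists>u. point_source_solution (f ` ball 0 1) (f 0) u \<and>
        (\<forall>\<theta>\<in>{0..2 * pi}.
           has_interior_normal_derivative u (\<phi> (arclength f \<theta>)) (f ` ball 0 1) (f (cis \<theta>)))) \<and>
     (\<forall>s. \<phi> (s + perimeter f) = \<phi> s)"

section \<open>The geometric setting\<close>

definition C1_holder_domain :: "real \<Rightarrow> complex set \<Rightarrow> bool" where
  "C1_holder_domain \<alpha> \<Omega> \<longleftrightarrow>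
     open \<Omega> \<and> bounded \<Omega> \<and> simply_connected \<Omega> \<and> C1_holder_boundary \<alpha> \<Omega>"

definition is_conformal_map ::
    "real \<Rightarrow> complex set \<Rightarrow> complex \<Rightarrow> complex \<Rightarrow> (complex \<Rightarrow> complex) \<Rightarrow> bool" where
  "is_conformal_map \<alpha> \<Omega> \<zeta>\<^sub>o \<zeta> f \<longleftrightarrow>
     C1_holder_on \<alpha> (cball 0 1) f \<and> inj_on f (cball 0 1) \<and> f holomorphic_on ball 0 1 \<and>
     f ` ball 0 1 = \<Omega> \<and> f 0 = \<zeta>\<^sub>o \<and> f 1 = \<zeta>"

definition hausdorff_dist :: "'a::metric_space set \<Rightarrow> 'a set \<Rightarrow> real" where
  "hausdorff_dist A B = max (SUP a\<in>A. infdist a B) (SUP b\<in>B. infdist b A)"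

definition rotate_about :: "complex \<Rightarrow> real \<Rightarrow> complex \<Rightarrow> complex" where
  "rotate_about c \<beta> z = c + cis \<beta> * (z - c)"

end

theory Submission
  imports Defs
begin

text \<open>By the maximum principle the Green function is \<open>- ln \<bar>f\<inverse>\<bar> / 2\<pi>\<close>, so that
  \<open>\<phi> = 1 / (2\<pi>\<bar>f'\<bar>)\<close> along the boundary; a zero of \<open>f'\<close> on the circle would make the normal
  derivative infinite. The arclength \<open>s\<close> then solves \<open>s' = 1 / (2\<pi> \<phi> s)\<close>, that is, the integral
  of \<open>\<phi>\<close> over \<open>[0, s \<theta>]\<close> is \<open>\<theta> / 2\<pi>\<close>, and comparing these integrals for the two domains shows
  that \<open>ln \<bar>f1'\<bar>\<close> and \<open>ln \<bar>f2'\<bar>\<close> differ by at most \<open>\<epsilon> = O(\<delta>)\<close> on the circle, where \<open>\<delta>\<close> is the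
  sup distance of the rescaled profiles plus \<open>\<bar>L1 - L2\<bar>\<close>. After a rotation,
  \<open>G = ln (f1' / f2')\<close> is real at \<open>0\<close> and \<open>\<bar>Re G\<bar> \<le> \<epsilon>\<close>, so \<open>G\<close> grows at most like a multiple of
  \<open>\<epsilon> / sqrt (1 - \<bar>z\<bar>)\<close>. This is integrable along radii, whence \<open>\<bar>f1 - f2\<bar> = O(\<epsilon>)\<close> uniformly. The
  resulting bound is linear in \<open>\<delta>\<close>; since \<open>\<delta>\<close> is bounded, it implies the one with \<open>\<delta> powr \<alpha>\<close>.\<close>

section \<open>Harmonic functions\<close>

text \<open>At a maximum \<open>g' 0 = 0\<close>, so \<open>D > 0\<close> would make
  \<open>g'\<close> positive just to the right of \<open>0\<close>, and by the mean value theorem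
  \<open>g\<close> would rise above \<open>g 0\<close>.\<close>

lemma second_derivative_nonpos_at_max:
  fixes g g' :: "real \<Rightarrow> real"
  assumes r: "0 < r" and g: "\<And>t. \<bar>t\<bar> < r \<Longrightarrow> (g has_real_derivative g' t) (at t)"
    and g': "(g' has_real_derivative D) (at 0)"
    and max: "\<And>t. \<bar>t\<bar> < r \<Longrightarrow> g t \<le> g 0"
  shows "D \<le> 0"
proof (rule ccontr)
  assume "\<not> D \<le> 0"
  then obtain d where d: "d > 0" "\<And>h. h > 0 \<Longrightarrow> h < d \<Longrightarrow> g' 0 < g' h"
    using DERIV_pos_inc_right[OF g'] by auto
  have g0: "g' 0 = 0"
    using DERIV_local_max[OF g[of 0] r] max r by auto
  define h where "h = min d r / 2"
  have h: "0 < h" "h < d" "h < r" using d(1) r by (auto simp: h_def)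
  obtain \<xi> where \<xi>: "0 < \<xi>" "\<xi> < h" "g h - g 0 = (h - 0) * g' \<xi>"
    using MVT2[of 0 h g g'] h g by auto
  have "(h - 0) * g' \<xi> > 0" using d(2)[of \<xi>] \<xi> h g0 by auto
  with \<xi>(3) max[of h] h show False by auto
qed

lemma harmonic_on_diff:
  assumes "harmonic_on S u" "harmonic_on S v"
  shows "harmonic_on S (\<lambda>z. u z - v z)"
proof -
  obtain ux uy uxx uxy uyx uyy where u: "\<And>z. z \<in> S \<Longrightarrow> (u has_derivative (\<lambda>h. ux z * Re h + uy z * Im h)) (at z)"
      "\<And>z. z \<in> S \<Longrightarrow> (ux has_derivative (\<lambda>h. uxx z * Re h + uxy z * Im h)) (at z)"
      "\<And>z. z \<in> S \<Longrightarrow> (uy has_derivative (\<lambda>h. uyx z * Re h + uyy z * Im h)) (at z)"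
      "\<And>z. z \<in> S \<Longrightarrow> uxx z + uyy z = 0"
      "continuous_on S uxx" "continuous_on S uxy" "continuous_on S uyx" "continuous_on S uyy"
    using assms(1) unfolding harmonic_on_def by blast
  obtain vx vy vxx vxy vyx vyy where v: "\<And>z. z \<in> S \<Longrightarrow> (v has_derivative (\<lambda>h. vx z * Re h + vy z * Im h)) (at z)"
      "\<And>z. z \<in> S \<Longrightarrow> (vx has_derivative (\<lambda>h. vxx z * Re h + vxy z * Im h)) (at z)"
      "\<And>z. z \<in> S \<Longrightarrow> (vy has_derivative (\<lambda>h. vyx z * Re h + vyy z * Im h)) (at z)"
      "\<And>z. z \<in> S \<Longrightarrow> vxx z + vyy z = 0"
      "continuous_on S vxx" "continuous_on S vxy" "continuous_on S vyx" "continuous_on S vyy"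
    using assms(2) unfolding harmonic_on_def by blast
  have lin: "((\<lambda>z. p z - q z) has_derivative (\<lambda>h. (a - a') * Re h + (b - b') * Im h)) (at z)"
    if "(p has_derivative (\<lambda>h. a * Re h + b * Im h)) (at z)"
      "(q has_derivative (\<lambda>h. a' * Re h + b' * Im h)) (at z)" for p q :: "complex \<Rightarrow> real" and a a' b b' z
    using has_derivative_diff[OF that] by (simp add: algebra_simps)
  show ?thesis
    unfolding harmonic_on_def
  proof (rule exI[of _ "\<lambda>z. ux z - vx z"], rule exI[of _ "\<lambda>z. uy z - vy z"],
      rule exI[of _ "\<lambda>z. uxx z - vxx z"], rule exI[of _ "\<lambda>z. uxy z - vxy z"],
      rule exI[of _ "\<lambda>z. uyx z - vyx z"], rule exI[of _ "\<lambda>z. uyy z - vyy z"], intro conjI ballI)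
    fix z assume z: "z \<in> S"
    show "uxx z - vxx z + (uyy z - vyy z) = 0" using u(4)[OF z] v(4)[OF z] by simp
  qed (use u v in \<open>auto intro!: lin continuous_intros\<close>)
qed

lemma harmonic_on_cong:
  assumes "open S" "harmonic_on S u" "\<And>z. z \<in> S \<Longrightarrow> u z = v z"
  shows "harmonic_on S v"
proof -
  have "(v has_derivative D) (at z)" if "(u has_derivative D) (at z)" "z \<in> S" for D z
    using that assms(1,3) by (metis has_derivative_transform_within_open)
  thus ?thesis using assms(2) unfolding harmonic_on_def by meson
qed

lemma harmonic_on_const: "harmonic_on S (\<lambda>_. c)"
  unfolding harmonic_on_def by (intro exI[of _ "\<lambda>_. 0"]) auto

text \<open>By the Cauchy-Riemann equations the gradient of \<open>Re l\<close> is
  \<open>(Re l', - Im l')\<close>. The same computation for \<open>l'\<close> gives the pure second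
  derivatives \<open>Re l''\<close> and \<open>- Re l''\<close>, which cancel.\<close>

lemma harmonic_on_Re:
  assumes "open S" and l: "l holomorphic_on S"
  shows "harmonic_on S (\<lambda>z. Re (l z))"
proof -
  have l': "deriv l holomorphic_on S" and l'': "deriv (deriv l) holomorphic_on S"
    using assms by (auto intro!: holomorphic_deriv)
  have der: "((\<lambda>z. Re (k z)) has_derivative (\<lambda>h. Re (deriv k z) * Re h + (- Im (deriv k z)) * Im h)) (at z)"
    "((\<lambda>z. - Im (k z)) has_derivative (\<lambda>h. - Im (deriv k z) * Re h + (- Re (deriv k z)) * Im h)) (at z)"
    if "k holomorphic_on S" "z \<in> S" for k z
  proof -
    have k: "(k has_derivative (\<lambda>h. deriv k z * h)) (at z)"
      using holomorphic_derivI[OF that(1) \<open>open S\<close> that(2)] by (simp add: has_field_derivative_def)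
    show "((\<lambda>z. Re (k z)) has_derivative (\<lambda>h. Re (deriv k z) * Re h + (- Im (deriv k z)) * Im h)) (at z)"
      using bounded_linear.has_derivative[OF bounded_linear_Re k] by simp
    show "((\<lambda>z. - Im (k z)) has_derivative (\<lambda>h. - Im (deriv k z) * Re h + (- Re (deriv k z)) * Im h)) (at z)"
      using has_derivative_minus[OF bounded_linear.has_derivative[OF bounded_linear_Im k]]
      by (simp add: algebra_simps)
  qed
  have cont: "continuous_on S (deriv (deriv l))" using l'' by (rule holomorphic_on_imp_continuous_on)
  show ?thesis
    unfolding harmonic_on_def
    by (rule exI[of _ "\<lambda>z. Re (deriv l z)"], rule exI[of _ "\<lambda>z. - Im (deriv l z)"],
        rule exI[of _ "\<lambda>z. Re (deriv (deriv l) z)"], rule exI[of _ "\<lambda>z. - Im (deriv (deriv l) z)"],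
        rule exI[of _ "\<lambda>z. - Im (deriv (deriv l) z)"], rule exI[of _ "\<lambda>z. - Re (deriv (deriv l) z)"],
        intro conjI ballI der l l' continuous_intros cont) auto
qed

text \<open>Adding \<open>e \<bar>z\<bar>\<^sup>2\<close> makes the Laplacian positive, which excludes interior maxima.\<close>

lemma harmonic_max_principle:
  assumes S: "open S" "bounded S" and V: "harmonic_on S V" "continuous_on (closure S) V"
    and fr: "\<And>z. z \<in> frontier S \<Longrightarrow> V z \<le> 0" and z: "z \<in> S"
  shows "V z \<le> 0"
proof (rule ccontr)
  assume "\<not> V z \<le> 0"
  hence Vz: "V z > 0" by simp
  obtain ux uy uxx uxy uyx uyy where u: "\<And>z. z \<in> S \<Longrightarrow> (V has_derivative (\<lambda>h. ux z * Re h + uy z * Im h)) (at z)"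
      "\<And>z. z \<in> S \<Longrightarrow> (ux has_derivative (\<lambda>h. uxx z * Re h + uxy z * Im h)) (at z)"
      "\<And>z. z \<in> S \<Longrightarrow> (uy has_derivative (\<lambda>h. uyx z * Re h + uyy z * Im h)) (at z)"
      "\<And>z. z \<in> S \<Longrightarrow> uxx z + uyy z = 0"
    using V(1) unfolding harmonic_on_def by blast
  obtain B where B: "B > 0" "\<And>w. w \<in> closure S \<Longrightarrow> norm w \<le> B"
    using S(2) bounded_closure[of S] bounded_pos by blast
  \<comment> \<open>The added term is then at most \<open>e * B\<^sup>2 = V z / 2\<close> on the
    closure. On the frontier \<open>W\<close> stays below \<open>V z \<le> W z\<close>, so its
    maximum is attained inside.\<close>
  define e where "e = V z / (2 * B\<^sup>2)"
  have e: "e > 0" using Vz B by (simp add: e_def)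
  define W where "W w = V w + e * ((Re w)\<^sup>2 + (Im w)\<^sup>2)" for w
  have "compact (closure S)" using S by (simp add: compact_closure)
  moreover have "continuous_on (closure S) W" unfolding W_def by (intro continuous_intros V)
  moreover have "closure S \<noteq> {}" using z by auto
  ultimately obtain p where p: "p \<in> closure S" "\<And>w. w \<in> closure S \<Longrightarrow> W w \<le> W p"
    using continuous_attains_sup[of "closure S" W] by blast
  have "p \<in> S"
  proof (rule ccontr)
    assume "p \<notin> S"
    hence "p \<in> frontier S" using p(1) S by (simp add: frontier_def interior_open)
    hence "W p \<le> e * (norm p)\<^sup>2" using fr by (simp add: W_def cmod_power2)
    also have "\<dots> \<le> e * B\<^sup>2" using B(2)[OF p(1)] e by (intro mult_left_mono power_mono) auto
    also have "\<dots> < V z" using Vz B(1) by (simp add: e_def)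
    also have "\<dots> \<le> W z" using e by (simp add: W_def)
    also have "\<dots> \<le> W p" using p(2) z closure_subset by blast
    finally show False by simp
  qed
  then obtain r where r: "r > 0" "ball p r \<subseteq> S" using S(1) openE by blast
  have line: "p + of_real t * a \<in> S" if "\<bar>t\<bar> < r" "norm a = 1" for t a
    using that r(2) by (auto simp: dist_norm norm_mult)
  have cmp: "(k has_derivative (\<lambda>h. A * Re h + C * Im h)) (at (p + of_real t * a)) \<Longrightarrow>
      ((\<lambda>t. k (p + of_real t * a)) has_real_derivative A * Re a + C * Im a) (at t)"
    for k :: "complex \<Rightarrow> real" and A C a t
  proof -
    assume k: "(k has_derivative (\<lambda>h. A * Re h + C * Im h)) (at (p + of_real t * a))"
    have "((\<lambda>t. p + of_real t * a) has_derivative (\<lambda>t. of_real t * a)) (at t)"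
      by (auto intro!: derivative_eq_intros)
    from has_derivative_compose[OF this k] show ?thesis
      unfolding has_field_derivative_def by (rule has_derivative_eq_rhs) (auto simp: algebra_simps)
  qed
  have Wmax: "W (p + of_real t * a) \<le> W p" if "\<bar>t\<bar> < r" "norm a = 1" for t a
    using p(2) line[OF that] closure_subset by blast
  \<comment> \<open>\<open>W\<close> is restricted to the horizontal line through \<open>p\<close>,
    then to the vertical one. The two inequalities add up to \<open>4 * e \<le> 0\<close>, since the
    Laplacian of \<open>V\<close> vanishes.\<close>
  have "uxx p + 2 * e \<le> 0"
  proof (rule second_derivative_nonpos_at_max[OF r(1),
        of "\<lambda>t. W (p + of_real t * 1)" "\<lambda>t. ux (p + of_real t * 1) + 2 * e * (Re p + t)"])
    show "((\<lambda>t. W (p + of_real t * 1)) has_real_derivative ux (p + of_real t * 1) + 2 * e * (Re p + t)) (at t)"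
      if "\<bar>t\<bar> < r" for t
      unfolding W_def
      by (rule derivative_eq_intros cmp[OF u(1)[OF line[OF that]]] refl | simp)+
    show "((\<lambda>t. ux (p + of_real t * 1) + 2 * e * (Re p + t)) has_real_derivative uxx p + 2 * e) (at 0)"
      using cmp[of ux "uxx p" "uxy p" 0 1] u(2)[OF \<open>p \<in> S\<close>]
      by (auto intro!: derivative_eq_intros)
    show "W (p + of_real t * 1) \<le> W (p + of_real 0 * 1)" if "\<bar>t\<bar> < r" for t
      using Wmax[OF that, of 1] by simp
  qed
  moreover have "uyy p + 2 * e \<le> 0"
  proof (rule second_derivative_nonpos_at_max[OF r(1),
        of "\<lambda>t. W (p + of_real t * \<i>)" "\<lambda>t. uy (p + of_real t * \<i>) + 2 * e * (Im p + t)"])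
    show "((\<lambda>t. W (p + of_real t * \<i>)) has_real_derivative uy (p + of_real t * \<i>) + 2 * e * (Im p + t)) (at t)"
      if "\<bar>t\<bar> < r" for t
      unfolding W_def
      by (rule derivative_eq_intros cmp[OF u(1)[OF line[OF that]]] refl | simp)+
    show "((\<lambda>t. uy (p + of_real t * \<i>) + 2 * e * (Im p + t)) has_real_derivative uyy p + 2 * e) (at 0)"
      using cmp[of uy "uyx p" "uyy p" 0 \<i>] u(3)[OF \<open>p \<in> S\<close>]
      by (auto intro!: derivative_eq_intros)
    show "W (p + of_real t * \<i>) \<le> W (p + of_real 0 * \<i>)" if "\<bar>t\<bar> < r" for t
      using Wmax[OF that, of \<i>] by simp
  qed
  ultimately show False using u(4)[OF \<open>p \<in> S\<close>] e by simp
qed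

lemma harmonic_zero_boundary:
  assumes S: "open S" "bounded S" and V: "harmonic_on S V" "continuous_on (closure S) V"
    and fr: "\<And>z. z \<in> frontier S \<Longrightarrow> V z = 0" and z: "z \<in> S"
  shows "V z = 0"
proof -
  have "V z \<le> 0" using harmonic_max_principle[OF S V _ z] fr by simp
  moreover have "0 - V z \<le> 0"
    by (rule harmonic_max_principle[OF S harmonic_on_diff[OF harmonic_on_const V(1)] _ _ z])
      (use fr in \<open>auto intro!: continuous_intros V\<close>)
  ultimately show ?thesis by simp
qed

section \<open>The Green function of a conformal image of the disc\<close>

text \<open>On the circle \<open>f'\<close> is a derivative within the closed disc and may a priori
  vanish. Zeros inside are excluded by injectivity, zeros on the circle later by finiteness of the
  normal derivative.\<close>

locale C1_conformal_map =
  fixes f f' :: "complex \<Rightarrow> complex"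
  assumes deriv: "\<And>z. z \<in> cball 0 1 \<Longrightarrow> (f has_field_derivative f' z) (at z within cball 0 1)"
    and cont_deriv: "continuous_on (cball 0 1) f'"
    and inj: "inj_on f (cball 0 1)"
begin

abbreviation "\<Omega> \<equiv> f ` ball 0 1"

definition finv where "finv = inv_into (cball 0 1) f"

lemma finv_f [simp]: "norm z \<le> 1 \<Longrightarrow> finv (f z) = z"
  unfolding finv_def using inj by (intro inv_into_f_f) auto

lemma continuous_f: "continuous_on (cball 0 1) f"
  using deriv by (meson DERIV_continuous continuous_on_eq_continuous_within)

lemma deriv_interior: "z \<in> ball 0 1 \<Longrightarrow> (f has_field_derivative f' z) (at z)"
  using deriv[of z] at_within_interior[of z "cball 0 1"] by auto

lemma holomorphic_f: "f holomorphic_on ball 0 1"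
  unfolding holomorphic_on_open[OF open_ball] using deriv_interior by blast

lemma inj_ball: "inj_on f (ball 0 1)"
  using inj by (rule inj_on_subset) auto

lemma deriv_nonzero_interior: "z \<in> ball 0 1 \<Longrightarrow> f' z \<noteq> 0"
  using holomorphic_injective_imp_regular[OF holomorphic_f open_ball inj_ball, of z]
    DERIV_imp_deriv[OF deriv_interior] by simp

lemma open_domain: "open \<Omega>"
  by (rule open_mapping_thm3[OF holomorphic_f open_ball inj_ball])

lemma closure_domain: "closure \<Omega> = f ` cball 0 1"
proof
  have "compact (f ` cball 0 1)" by (intro compact_continuous_image continuous_f) auto
  thus "closure \<Omega> \<subseteq> f ` cball 0 1"
    by (intro closure_minimal image_mono compact_imp_closed) auto
  show "f ` cball 0 1 \<subseteq> closure \<Omega>"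
    using image_closure_subset[of "ball 0 1" f "closure \<Omega>"] continuous_f closure_subset[of \<Omega>]
    by simp
qed

lemma bounded_domain: "bounded \<Omega>"
proof -
  have "compact (f ` cball 0 1)" by (intro compact_continuous_image continuous_f) auto
  thus ?thesis by (rule bounded_subset[OF compact_imp_bounded]) auto
qed

lemma frontier_domain: "frontier \<Omega> = f ` sphere 0 1"
proof -
  have "f ` cball 0 1 - f ` ball 0 1 = f ` (cball 0 1 - ball 0 1)"
    using inj by (intro inj_on_image_set_diff[symmetric]) auto
  also have "cball 0 1 - ball 0 1 = sphere (0::complex) 1" by auto
  finally show ?thesis
    unfolding frontier_def closure_domain interior_open[OF open_domain] .
qed

lemma continuous_finv: "continuous_on (closure \<Omega>) finv"
  unfolding closure_domain by (rule continuous_on_inv[OF continuous_f]) auto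

lemma holomorphic_finv: "finv holomorphic_on \<Omega>"
proof -
  obtain k where k: "k holomorphic_on \<Omega>" "\<And>z. z \<in> ball 0 1 \<Longrightarrow> k (f z) = z"
    using holomorphic_has_inverse[OF holomorphic_f open_ball inj_ball] by metis
  show ?thesis by (rule holomorphic_transform[OF k(1)]) (use k(2) in auto)
qed

text \<open>Adding \<open>ln \<bar>finv\<bar> / 2\<pi>\<close> to \<open>u\<close> removes the
  singularity at the pole. The sum is harmonic in the whole domain and vanishes on the boundary,
  hence is zero by the maximum principle.\<close>

lemma point_source_solution_eq:
  assumes u: "point_source_solution \<Omega> (f 0) u" and z: "z \<in> ball 0 1" "z \<noteq> 0"
  shows "u (f z) = - ln (norm z) / (2 * pi)"
proof -
  obtain h where h: "harmonic_on \<Omega> h"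
      "\<And>w. w \<in> \<Omega> - {f 0} \<Longrightarrow> u w = - ln (cmod (w - f 0)) / (2 * pi) + h w"
    and cu: "continuous_on (closure \<Omega> - {f 0}) u" and u0: "\<And>z. z \<in> frontier \<Omega> \<Longrightarrow> u z = 0"
    using u unfolding point_source_solution_def by blast
  \<comment> \<open>The divided difference of \<open>f\<close> at \<open>0\<close> is holomorphic
    and, by injectivity, zero-free, so it has a logarithm \<open>l\<close>. Thus
    \<open>ln \<bar>f z - f 0\<bar> = ln \<bar>z\<bar> + Re (l z)\<close> isolates the singular
    part.\<close>
  define k where "k z = (if z = 0 then deriv f 0 else (f z - f 0) / (z - 0))" for z
  have holk: "k holomorphic_on ball 0 1"
    unfolding k_def by (rule pole_lemma_open[OF holomorphic_f open_ball])
  have k0: "k z \<noteq> 0" if "z \<in> ball 0 1" for z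
    using holomorphic_injective_imp_regular[OF holomorphic_f open_ball inj_ball, of 0]
      inj_onD[OF inj_ball, of z 0] that by (auto simp: k_def)
  obtain l where l: "l holomorphic_on ball 0 1" "\<And>z. z \<in> ball 0 1 \<Longrightarrow> k z = exp (l z)"
    using contractible_imp_holomorphic_log[OF holk convex_imp_contractible[OF convex_ball]] k0 by metis
  \<comment> \<open>This is \<open>u + ln \<bar>finv\<bar> / 2\<pi>\<close> with the two logarithmic
    singularities cancelled, hence meaningful at \<open>f 0\<close> too. The value \<open>0\<close>
    outside the domain matches the boundary values and gives continuity on the closure.\<close>
  define V where "V w = (if w \<in> \<Omega> then h w - Re (l (finv w) / of_real (2 * pi)) else 0)" for w
  have V: "V w = u w + ln (norm (finv w)) / (2 * pi)" if "w \<in> closure \<Omega> - {f 0}" for w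
  proof (cases "w \<in> \<Omega>")
    case True
    then obtain y where y: "y \<in> ball 0 1" "w = f y" by blast
    have y0: "y \<noteq> 0" using that y by auto
    have fy: "f y \<noteq> f 0" using that y by auto
    have "exp (Re (l y)) = norm (f y - f 0) / norm y"
      using arg_cong[OF l(2)[OF y(1)], of norm] y0 by (simp add: k_def norm_divide)
    hence "Re (l y) = ln (norm (f y - f 0) / norm y)" by (metis ln_exp)
    also have "\<dots> = ln (norm (f y - f 0)) - ln (norm y)"
      using fy y0 by (simp add: ln_div)
    finally have "Re (l y) = ln (norm (f y - f 0)) - ln (norm y)" .
    thus ?thesis using h(2)[of w] True that y by (simp add: V_def field_simps)
  next
    case False
    hence "w \<in> frontier \<Omega>" using that by (simp add: frontier_def interior_open[OF open_domain])
    moreover from this obtain y where "norm y = 1" "w = f y" unfolding frontier_domain by auto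
    ultimately show ?thesis using u0 False by (simp add: V_def)
  qed
  have "V (f z) = 0"
  proof (rule harmonic_zero_boundary[OF open_domain bounded_domain])
    have "harmonic_on \<Omega> (\<lambda>w. h w - Re (l (finv w) / of_real (2 * pi)))"
    proof (intro harmonic_on_diff h harmonic_on_Re open_domain holomorphic_intros)
      show "(\<lambda>w. l (finv w)) holomorphic_on \<Omega>"
        using holomorphic_on_compose_gen[OF holomorphic_finv l(1)] by (simp add: o_def image_subset_iff)
    qed auto
    note hV = this
    have "(\<lambda>w. h w - Re (l (finv w) / of_real (2 * pi))) differentiable at w" if "w \<in> \<Omega>" for w
      using hV that unfolding harmonic_on_def differentiable_def by blast
    hence cV: "continuous_on \<Omega> (\<lambda>w. h w - Re (l (finv w) / of_real (2 * pi)))"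
      by (meson differentiable_imp_continuous_within continuous_at_imp_continuous_on)
    show "harmonic_on \<Omega> V"
      by (rule harmonic_on_cong[OF open_domain hV]) (simp add: V_def)
    show "continuous_on (closure \<Omega>) V"
    proof -
      \<comment> \<open>Continuity is glued from two overlapping pieces: inside the domain from
        harmonicity, away from the pole from the formula with \<open>u\<close>.\<close>
      have 1: "continuous_on \<Omega> V" using cV by (rule continuous_on_eq) (simp add: V_def)
      have "continuous_on (closure \<Omega> - {f 0}) (\<lambda>w. u w + ln (norm (finv w)) / (2 * pi))"
      proof (intro continuous_intros cu)
        show "continuous_on (closure \<Omega> - {f 0}) finv" using continuous_finv by (rule continuous_on_subset) auto
        show "\<forall>x\<in>closure \<Omega> - {f 0}. norm (finv x) \<noteq> 0"
          by (auto simp: closure_domain)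
      qed auto
      hence 2: "continuous_on (closure \<Omega> - {f 0}) V" by (rule continuous_on_eq) (simp add: V)
      have "continuous (at w within closure \<Omega>) V" if w: "w \<in> closure \<Omega>" for w
      proof (cases "w \<in> \<Omega>")
        case True
        hence "isCont V w" using 1 continuous_on_eq_continuous_at[OF open_domain] by blast
        thus ?thesis by (rule continuous_at_imp_continuous_within)
      next
        case False
        hence "w \<noteq> f 0" by auto
        hence "at w within (closure \<Omega> - {f 0}) = at w within closure \<Omega>"
          by (intro at_within_nhd[of _ "- {f 0}"]) auto
        thus ?thesis using 2 w \<open>w \<noteq> f 0\<close> unfolding continuous_on_eq_continuous_within
          by (metis Diff_iff singletonD)
      qed
      thus ?thesis by (simp add: continuous_on_eq_continuous_within)
    qed
    show "V w = 0" if "w \<in> frontier \<Omega>" for w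
      using that by (simp add: V_def frontier_def interior_open[OF open_domain])
  qed (use z in auto)
  moreover have "f z \<noteq> f 0" using inj_onD[OF inj_ball, of z 0] z by auto
  ultimately show ?thesis using V[of "f z"] z closure_subset[of \<Omega>] by (auto simp: subset_iff)
qed

end

section \<open>Normal derivatives on the boundary\<close>

text \<open>A frontier point is outside the open set, so it is not above the graph. Strictly below
  the graph it would, by continuity of \<open>\<gamma>\<close>, have a neighbourhood that misses the
  set.\<close>

lemma boundary_chart_frontier:
  assumes ch: "boundary_chart \<Omega> x w r \<gamma>" and \<gamma>: "continuous_on {-r..r} \<gamma>"
    and y: "y \<in> frontier \<Omega>" "y \<in> ball x r" and "open \<Omega>"
  shows "Im (cnj w * (y - x)) = \<gamma> (Re (cnj w * (y - x)))"
proof (rule antisym)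
  have w: "norm w = 1" and \<Omega>: "\<And>y. y \<in> ball x r \<Longrightarrow> y \<in> \<Omega> \<longleftrightarrow> \<gamma> (Re (cnj w * (y - x))) < Im (cnj w * (y - x))"
    using ch by (auto simp: boundary_chart_def)
  have "y \<notin> \<Omega>" using y \<open>open \<Omega>\<close> by (simp add: frontier_def interior_open)
  thus "Im (cnj w * (y - x)) \<le> \<gamma> (Re (cnj w * (y - x)))" using \<Omega>[OF y(2)] by auto
  define F where "F z = Im (cnj w * (z - x)) - \<gamma> (Re (cnj w * (z - x)))" for z
  have "continuous_on (ball x r) (\<lambda>z. \<gamma> (Re (cnj w * (z - x))))"
  proof (rule continuous_on_compose2[OF \<gamma>])
    show "(\<lambda>z. Re (cnj w * (z - x))) ` ball x r \<subseteq> {-r..r}"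
    proof clarify
      fix z assume z: "z \<in> ball x r"
      have "\<bar>Re (cnj w * (z - x))\<bar> \<le> norm (cnj w * (z - x))" by (rule abs_Re_le_cmod)
      also have "\<dots> < r" using z w by (simp add: norm_mult dist_norm norm_minus_commute)
      finally show "Re (cnj w * (z - x)) \<in> {-r..r}" by auto
    qed
  qed (intro continuous_intros)
  hence "continuous_on (ball x r) F" unfolding F_def by (intro continuous_intros)
  hence "open (ball x r \<inter> F -` {..<0})" by (intro continuous_open_preimage) auto
  moreover have "ball x r \<inter> F -` {..<0} \<inter> \<Omega> = {}" using \<Omega> by (auto simp: F_def)
  ultimately have "ball x r \<inter> F -` {..<0} \<inter> closure \<Omega> = {}" by (metis open_Int_closure_eq_empty)
  thus "\<gamma> (Re (cnj w * (y - x))) \<le> Im (cnj w * (y - x))"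
    using y by (force simp: F_def frontier_def)
qed

text \<open>The graph deviates little from its tangent line at \<open>x\<close>, so a short step of
  length \<open>t\<close> along the normal enters the domain and keeps a distance comparable to
  \<open>t\<close> from the whole boundary. The distance bound later rules out \<open>f' = 0\<close>
  on the circle.\<close>

lemma boundary_chart_near_normal:
  assumes ch: "boundary_chart \<Omega> x w r \<gamma>" and cont: "continuous_on {-r..r} \<gamma>"
    and \<gamma>: "(\<gamma> has_real_derivative c) (at 0)" and "open \<Omega>" and x: "x \<in> frontier \<Omega>"
    and \<nu>: "\<nu> = w * Complex (- c) 1 / of_real (sqrt (1 + c\<^sup>2))"
  shows "norm \<nu> = 1"
    and "\<forall>\<^sub>F t in at_right 0. x + of_real t * \<nu> \<in> \<Omega> \<and>
           (\<forall>y\<in>frontier \<Omega>. t / 2 \<le> dist (x + of_real t * \<nu>) y)"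
proof -
  have w: "norm w = 1" and r: "r > 0" and \<Omega>: "\<And>y. y \<in> ball x r \<Longrightarrow> y \<in> \<Omega> \<longleftrightarrow> \<gamma> (Re (cnj w * (y - x))) < Im (cnj w * (y - x))"
    using ch by (auto simp: boundary_chart_def)
  define s where "s = sqrt (1 + c\<^sup>2)"
  have s: "s \<ge> 1" "s\<^sup>2 = 1 + c\<^sup>2" by (auto simp: s_def)
  define n where "n = Complex (- c) 1 / of_real s"
  have nRe: "Re n = - c / s" and nIm: "Im n = 1 / s" by (auto simp: n_def)
  have "norm (Complex (- c) 1) = s" by (simp add: s_def cmod_def add.commute)
  hence n1: "norm n = 1" using s by (simp add: n_def norm_divide)
  have \<nu>n: "\<nu> = w * n" by (simp add: \<nu> n_def s_def)
  show \<nu>1: "norm \<nu> = 1" using n1 w by (simp add: \<nu>n norm_mult)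
  have ww: "cnj w * w = 1" using w by (metis complex_norm_square mult.commute of_real_1 power_one)
  have wn: "cnj w * \<nu> = n" using ww by (simp add: \<nu>n flip: mult.assoc)
  have \<gamma>0: "\<gamma> 0 = 0"
    using boundary_chart_frontier[OF ch cont x _ \<open>open \<Omega>\<close>] r by simp
  \<comment> \<open>The slope error \<open>1/3\<close> serves the distance estimate: a boundary
    point within \<open>t / 2\<close> of \<open>x + t * \<nu>\<close> is within
    \<open>3/2 * t\<close> of \<open>x\<close>, so it deviates from the tangent line by at most
    \<open>t / 2\<close>, whereas \<open>x + t * \<nu>\<close> is at distance \<open>t\<close> from
    that line.\<close>
  obtain d where d: "d > 0" "\<And>a. \<bar>a\<bar> < d \<Longrightarrow> \<bar>\<gamma> a - c * a\<bar> \<le> 1/3 * \<bar>a\<bar>"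
  proof -
    have "\<forall>e>0. \<exists>d>0. \<forall>y. norm (y - 0) < d \<longrightarrow> norm (\<gamma> y - \<gamma> 0 - c * (y - 0)) \<le> e * norm (y - 0)"
      using \<gamma> unfolding has_field_derivative_def has_derivative_at_alt by blast
    from this[rule_format, of "1/3"] \<gamma>0 show ?thesis using that by auto
  qed
  \<comment> \<open>The halving keeps all points within \<open>3/2 * t\<close> of \<open>x\<close>
    inside the chart and inside the range of the slope estimate.\<close>
  define t0 where "t0 = min d r / 2"
  have "\<forall>\<^sub>F t in at_right 0. 0 < t \<and> t < t0"
    using eventually_at_right_real[of 0 t0] d(1) r by (simp add: t0_def)
  thus "\<forall>\<^sub>F t in at_right 0. x + of_real t * \<nu> \<in> \<Omega> \<and>
           (\<forall>y\<in>frontier \<Omega>. t / 2 \<le> dist (x + of_real t * \<nu>) y)"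
  proof eventually_elim
    case (elim t)
    have t: "0 < t" "t < d" "2 * t < r" "2 * t < d" using elim by (auto simp: t0_def)
    have wP: "cnj w * (x + of_real t * \<nu> - x) = of_real t * n" using wn by (simp add: algebra_simps)
    have "x + of_real t * \<nu> \<in> \<Omega>"
    proof (subst \<Omega>)
      show "x + of_real t * \<nu> \<in> ball x r" using \<nu>1 t by (simp add: dist_norm norm_mult)
      have a: "\<bar>t * Re n\<bar> \<le> t" using n1 abs_Re_le_cmod[of n] t by (simp add: abs_mult)
      have "\<gamma> (t * Re n) \<le> c * (t * Re n) + 1/3 * \<bar>t * Re n\<bar>" 
      proof -
        have "\<bar>t * Re n\<bar> < d" using a t by linarith
        from abs_le_D1[OF d(2)[OF this]] show ?thesis by linarith
      qed
      also have "\<dots> = t / s * (\<bar>c\<bar> / 3 - c\<^sup>2)"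
        using t s by (simp add: nRe abs_mult power2_eq_square field_simps)
      also have "\<dots> < t / s * 1"
      proof (rule mult_strict_left_mono)
        \<comment> \<open>Completing the square shows that
          \<open>\<bar>c\<bar> / 3 - c\<^sup>2\<close> is at most \<open>1/36\<close>.\<close>
        have "0 \<le> (\<bar>c\<bar> - 1/6)\<^sup>2" by simp
        thus "\<bar>c\<bar> / 3 - c\<^sup>2 < 1" by (simp add: power2_eq_square algebra_simps)
        show "0 < t / s" using t s by simp
      qed
      finally show "\<gamma> (Re (cnj w * (x + of_real t * \<nu> - x))) < Im (cnj w * (x + of_real t * \<nu> - x))"
        unfolding wP by (simp add: nIm)
    qed
    moreover have "t / 2 \<le> dist (x + of_real t * \<nu>) y" if y: "y \<in> frontier \<Omega>" for y
    proof (rule ccontr)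
      assume "\<not> ?thesis"
      hence close: "dist (x + of_real t * \<nu>) y < t / 2" by simp
      define p where "p = cnj w * (y - x)"
      have "norm p = norm (y - x)" using w by (simp add: p_def norm_mult)
      also have "\<dots> \<le> dist (x + of_real t * \<nu>) y + norm (of_real t * \<nu>)"
        using norm_triangle_ineq4[of "of_real t * \<nu>" "x + of_real t * \<nu> - y"]
        by (simp add: dist_norm)
      finally have np: "norm p < 3/2 * t" using close t \<nu>1 by (simp add: norm_mult)
      have "y \<in> ball x r" using np t \<open>norm p = norm (y - x)\<close>
        by (simp add: dist_norm norm_minus_commute)
      hence "Im p = \<gamma> (Re p)"
        using boundary_chart_frontier[OF ch cont y _ \<open>open \<Omega>\<close>] by (simp add: p_def)
      hence b: "\<bar>Im p - c * Re p\<bar> \<le> 1/3 * \<bar>Re p\<bar>"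
        using d(2)[of "Re p"] np abs_Re_le_cmod[of p] t by auto
      \<comment> \<open>\<open>Re (cnj n * v)\<close> is the component of \<open>v\<close> along the
        normal \<open>n\<close> in chart coordinates. The tangent line contributes nothing to it, so
        only the deviation \<open>Im p - c * Re p\<close> remains.\<close>
      have "Re (cnj n * (of_real t * n - p)) = t - (Im p - c * Re p) / s"
      proof -
        have "cnj n * n = 1" using n1 by (metis complex_norm_square mult.commute of_real_1 power_one)
        moreover have "cnj n * (of_real t * n - p) = of_real t * (cnj n * n) - cnj n * p"
          by (simp add: algebra_simps)
        ultimately have "cnj n * (of_real t * n - p) = of_real t - cnj n * p" by simp
        moreover have "Re (of_real t - cnj n * p) = t - (Im p - c * Re p) / s"
          by (simp add: nRe nIm diff_divide_distrib)
        ultimately show ?thesis by simp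
      qed
      moreover have "\<bar>(Im p - c * Re p) / s\<bar> \<le> \<bar>Im p - c * Re p\<bar>"
        using s by (simp add: divide_le_eq mult_le_cancel_left1)
      moreover have "Re (cnj n * (of_real t * n - p)) \<le> norm (of_real t * n - p)"
        using complex_Re_le_cmod[of "cnj n * (of_real t * n - p)"] n1 by (simp add: norm_mult)
      moreover have "norm (of_real t * n - p) = dist (x + of_real t * \<nu>) y"
      proof -
        have "of_real t * n - p = cnj w * (x + of_real t * \<nu> - y)"
          by (simp add: p_def wn[symmetric] algebra_simps)
        thus ?thesis using w by (simp add: norm_mult dist_norm)
      qed
      ultimately show False using b np close abs_Re_le_cmod[of p] by linarith
    qed
    ultimately show ?case by blast
  qed
qed

section \<open>The normal derivative in terms of the conformal map\<close>

context C1_conformal_map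
begin

text \<open>\<open>\<i> e f' e\<close> is the tangent vector of the boundary curve \<open>f \<circ> cis\<close>.\<close>

lemma tangent_slope:
  assumes ch: "boundary_chart \<Omega> (f e) w r \<gamma>" and cont: "continuous_on {-r..r} \<gamma>"
    and \<gamma>: "(\<gamma> has_real_derivative c) (at 0)" and e: "norm e = 1"
  shows "Im (cnj w * (f' e * (\<i> * e))) = c * Re (cnj w * (f' e * (\<i> * e)))"
proof -
  obtain \<theta> where \<theta>: "e = cis \<theta>" using e by (metis cis_Arg_unique complex_norm_eq_1_exp cis_conv_exp)
  define \<kappa> where "\<kappa> \<tau> = cnj w * (f (cis \<tau>) - f e)" for \<tau>
  have "((\<lambda>\<tau>. f (cis \<tau>)) has_vector_derivative (\<i> * e) * f' e) (at \<theta>)"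
  proof -
    have "(cis has_vector_derivative \<i> * e) (at \<theta> within UNIV)"
      using has_derivative_cis[OF has_derivative_ident, of \<theta> UNIV]
      unfolding has_vector_derivative_def \<theta> by (simp add: scaleR_conv_of_real mult_ac)
    \<comment> \<open>At \<open>e\<close> the derivative is taken within the closed disc only. The
      circle lies in the disc, so it restricts to the range of \<open>cis\<close>, which is the form
      the chain rule needs.\<close>
    moreover have "(f has_field_derivative f' e) (at (cis \<theta>) within cis ` UNIV)"
      using deriv[of e] e by (rule_tac has_field_derivative_subset) (auto simp: \<theta>)
    ultimately show ?thesis
      using field_vector_diff_chain_within[of cis "\<i> * e" \<theta> UNIV f "f' e"] by (simp add: o_def)
  qed
  hence \<kappa>: "(\<kappa> has_vector_derivative cnj w * (f' e * (\<i> * e))) (at \<theta>)"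
    unfolding \<kappa>_def
    by (auto intro!: derivative_eq_intros has_vector_derivative_mult_right simp: mult_ac)
  have R: "((\<lambda>\<tau>. Re (\<kappa> \<tau>)) has_real_derivative Re (cnj w * (f' e * (\<i> * e)))) (at \<theta>)"
    and I: "((\<lambda>\<tau>. Im (\<kappa> \<tau>)) has_real_derivative Im (cnj w * (f' e * (\<i> * e)))) (at \<theta>)"
    using bounded_linear.has_vector_derivative[OF bounded_linear_Re \<kappa>]
      bounded_linear.has_vector_derivative[OF bounded_linear_Im \<kappa>]
    by (simp_all add: has_real_derivative_iff_has_vector_derivative)
  have \<kappa>0: "\<kappa> \<theta> = 0" by (simp add: \<kappa>_def \<theta>)
  have "((\<lambda>\<tau>. \<gamma> (Re (\<kappa> \<tau>))) has_real_derivative c * Re (cnj w * (f' e * (\<i> * e)))) (at \<theta>)"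
    using \<gamma> R \<kappa>0 by (intro DERIV_chain2) auto
  \<comment> \<open>Near \<open>\<theta>\<close> the curve stays on the graph, so
    \<open>Im \<kappa>\<close> and the composition of \<open>\<gamma>\<close> with
    \<open>Re \<kappa>\<close> are the same function there. Equality of their derivatives is the
    claim.\<close>
  moreover have ev: "\<forall>\<^sub>F \<tau> in nhds \<theta>. \<gamma> (Re (\<kappa> \<tau>)) = Im (\<kappa> \<tau>)"
  proof -
    have "continuous_on UNIV (\<lambda>\<tau>. f (cis \<tau>))"
      by (rule continuous_on_compose2[OF continuous_f]) (auto intro!: continuous_intros)
    hence "((\<lambda>\<tau>. f (cis \<tau>)) \<longlongrightarrow> f (cis \<theta>)) (nhds \<theta>)"
      using tendsto_at_iff_tendsto_nhds[of "\<lambda>\<tau>. f (cis \<tau>)" \<theta>]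
      by (simp add: continuous_on_eq_continuous_at isCont_def)
    moreover have "r > 0" using ch by (simp add: boundary_chart_def)
    ultimately have "\<forall>\<^sub>F \<tau> in nhds \<theta>. f (cis \<tau>) \<in> ball (f e) r"
      unfolding \<theta> by (intro topological_tendstoD[of _ "f (cis \<theta>)"]) auto
    thus ?thesis
    proof eventually_elim
      case (elim \<tau>)
      have "f (cis \<tau>) \<in> frontier \<Omega>" by (auto simp: frontier_domain)
      thus ?case using boundary_chart_frontier[OF ch cont _ elim open_domain] by (simp add: \<kappa>_def)
    qed
  qed
  ultimately have "((\<lambda>\<tau>. Im (\<kappa> \<tau>)) has_real_derivative c * Re (cnj w * (f' e * (\<i> * e)))) (at \<theta>)"
    using DERIV_cong_ev[OF refl ev refl] by blast
  thus ?thesis using I DERIV_unique by blast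
qed

text \<open>With \<open>Z t\<close> the preimage of the point at distance \<open>t\<close> along the
  normal, the difference quotient of \<open>u\<close> is
  \<open>- ln \<bar>Z t\<bar> / (2\<pi> t)\<close>. If \<open>f' e\<close> were zero, it would
  eventually be at least \<open>d + 1\<close>; otherwise its limit is computed from the derivatives
  of \<open>f\<close> and of the logarithm. The sign of \<open>d\<close> fixes the orientation of
  the boundary curve.\<close>

lemma normal_derivative_eq:
  assumes u: "point_source_solution \<Omega> (f 0) u" and e: "norm e = 1"
    and nd: "has_interior_normal_derivative u d \<Omega> (f e)" and d: "0 < d"
  shows "f' e \<noteq> 0" "d = 1 / (2 * pi * norm (f' e))"
proof -
  obtain \<nu> where "interior_normal \<Omega> (f e) \<nu>"
    and lim: "((\<lambda>t. (u (f e + of_real t * \<nu>) - u (f e)) / t) \<longlongrightarrow> d) (at_right 0)"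
    using nd unfolding has_interior_normal_derivative_def by blast
  then obtain w r \<gamma> c where ch: "boundary_chart \<Omega> (f e) w r \<gamma>" and cont: "continuous_on {-r..r} \<gamma>"
    and \<gamma>: "(\<gamma> has_real_derivative c) (at 0)"
    and \<nu>: "\<nu> = w * Complex (- c) 1 / of_real (sqrt (1 + c\<^sup>2))" and xfr: "f e \<in> frontier \<Omega>"
    unfolding interior_normal_def by blast
  note near = boundary_chart_near_normal[OF ch cont \<gamma> open_domain xfr \<nu>]
  define Z where "Z t = finv (f e + of_real t * \<nu>)" for t
  have Z: "\<forall>\<^sub>F t in at_right 0. 0 < t \<and> Z t \<in> ball 0 1 \<and> f (Z t) = f e + of_real t * \<nu> \<and>
      (\<forall>y\<in>frontier \<Omega>. t / 2 \<le> dist (f (Z t)) y)"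
    using near(2) eventually_at_right_less[of 0] by eventually_elim (auto simp: Z_def)
  have Zlim: "(Z \<longlongrightarrow> e) (at_right 0)"
  proof -
    have "(Z \<longlongrightarrow> finv (f e)) (at_right 0)"
      unfolding Z_def
    proof (rule continuous_on_tendsto_compose[OF continuous_finv])
      have "((\<lambda>t. f e + of_real t * \<nu>) \<longlongrightarrow> f e + of_real 0 * \<nu>) (at_right 0)"
        by (intro tendsto_intros)
      thus "((\<lambda>t. f e + of_real t * \<nu>) \<longlongrightarrow> f e) (at_right 0)" by simp
      show "f e \<in> closure \<Omega>" using e by (simp add: closure_domain)
      show "\<forall>\<^sub>F t in at_right 0. f e + of_real t * \<nu> \<in> closure \<Omega>"
        using near(2) by eventually_elim (meson closure_subset subsetD)
    qed
    thus ?thesis using e by simp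
  qed
  have e0: "e \<noteq> 0" using e by auto
  have Z0: "\<forall>\<^sub>F t in at_right 0. Z t \<noteq> 0"
    using tendsto_imp_eventually_ne[OF Zlim e0] .
  have uZ: "\<forall>\<^sub>F t in at_right 0. (u (f e + of_real t * \<nu>) - u (f e)) / t = - ln (norm (Z t)) / t / (2 * pi)"
    using Z Z0
  proof eventually_elim
    case (elim t)
    have "u (f e) = 0" using u xfr unfolding point_source_solution_def by blast
    thus ?case using point_source_solution_eq[OF u, of "Z t"] elim by simp
  qed
  have lnlim: "((\<lambda>t. - ln (norm (Z t)) / t / (2 * pi)) \<longlongrightarrow> d) (at_right 0)"
    using lim uZ by (rule Lim_transform_eventually)
  show fe: "f' e \<noteq> 0"
  proof
    assume fe: "f' e = 0"
    \<comment> \<open>Near \<open>e\<close> the map \<open>f\<close> has Lipschitz constant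
      \<open>\<eta>\<close>, so \<open>t / 2 \<le> \<eta> * (1 - \<bar>Z t\<bar>) \<le> - \<eta> *
      ln \<bar>Z t\<bar>\<close>. The value of \<open>\<eta>\<close> turns this into the lower bound
      \<open>d + 1\<close> for the difference quotient.\<close>
    define \<eta> where "\<eta> = 1 / (4 * pi * (d + 1))"
    have \<eta>: "\<eta> > 0" using d by (simp add: \<eta>_def)
    obtain \<delta> where \<delta>: "\<delta> > 0" "\<And>z. z \<in> cball 0 1 \<Longrightarrow> dist z e < \<delta> \<Longrightarrow> norm (f' z) < \<eta>"
      using cont_deriv[unfolded continuous_on_iff, rule_format, of e \<eta>] e \<eta> fe by (auto simp: dist_norm)
    have lip: "norm (f y - f z) \<le> \<eta> * norm (y - z)"
      if "y \<in> cball 0 1 \<inter> ball e \<delta>" "z \<in> cball 0 1 \<inter> ball e \<delta>" for y z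
    proof (rule field_differentiable_bound[of "cball 0 1 \<inter> ball e \<delta>" f f' \<eta>])
      show "(f has_field_derivative f' z) (at z within cball 0 1 \<inter> ball e \<delta>)"
        if "z \<in> cball 0 1 \<inter> ball e \<delta>" for z
        using that deriv[of z] has_field_derivative_subset by blast
      show "norm (f' z) \<le> \<eta>" if "z \<in> cball 0 1 \<inter> ball e \<delta>" for z
        using that \<delta>(2)[of z] by (auto simp: dist_commute less_imp_le)
    qed (use that in \<open>auto intro: convex_Int\<close>)
    have "\<forall>\<^sub>F t in at_right 0. dist (Z t) e < \<delta> / 2"
      using tendstoD[OF Zlim, of "\<delta> / 2"] \<delta>(1) by simp
    with Z Z0 have "\<forall>\<^sub>F t in at_right 0. d + 1 \<le> - ln (norm (Z t)) / t / (2 * pi)"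
    proof eventually_elim
      case (elim t)
      \<comment> \<open>The radial projection of \<open>Z t\<close> to the circle:
        \<open>f y\<close> is a boundary point, so \<open>f\<close> moves by at least
        \<open>t / 2\<close> over the distance \<open>1 - \<bar>Z t\<bar>\<close>.\<close>
      define y where "y = sgn (Z t)"
      have ny: "norm y = 1" using elim by (simp add: y_def norm_sgn)
      have "of_real (norm (Z t)) * y = Z t" using elim by (simp add: y_def sgn_eq)
      hence "y - Z t = of_real (1 - norm (Z t)) * y" by (simp add: left_diff_distrib)
      hence yZ: "norm (y - Z t) = 1 - norm (Z t)"
        using ny elim by (simp add: norm_mult del: of_real_diff)
      have "1 - norm (Z t) \<le> dist (Z t) e"
        using norm_triangle_ineq2[of e "Z t"] e by (simp add: dist_norm norm_minus_commute)
      hence "dist e y < \<delta>"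
        using dist_triangle[of e y "Z t"] yZ elim by (simp add: dist_norm norm_minus_commute)
      hence "norm (f (Z t) - f y) \<le> \<eta> * norm (Z t - y)"
        using elim \<delta>(1) ny by (intro lip) (auto simp: dist_commute)
      moreover have "t / 2 \<le> dist (f (Z t)) (f y)" using elim ny by (auto simp: frontier_domain)
      ultimately have "t / 2 \<le> \<eta> * (1 - norm (Z t))" using yZ by (simp add: dist_norm norm_minus_commute)
      also have "\<dots> \<le> \<eta> * (- ln (norm (Z t)))"
        using ln_le_minus_one[of "norm (Z t)"] elim \<eta> by (intro mult_left_mono) auto
      finally have "t / 2 \<le> - ln (norm (Z t)) / (4 * pi * (d + 1))" by (simp add: \<eta>_def)
      moreover have "4 * pi * (d + 1) > 0" using d by simp
      ultimately have "t / 2 * (4 * pi * (d + 1)) \<le> - ln (norm (Z t))"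
        by (simp only: pos_le_divide_eq)
      hence "(d + 1) * (t * (2 * pi)) \<le> - ln (norm (Z t))" by (simp add: algebra_simps)
      moreover have "t * (2 * pi) > 0" using elim by simp
      ultimately show ?case by (simp only: divide_divide_eq_left pos_le_divide_eq)
    qed
    hence "d + 1 \<le> d" using lnlim by (intro tendsto_lowerbound[of _ d "at_right 0"]) auto
    thus False by simp
  qed
  have filt: "filterlim Z (at e) (at_right 0)"
    unfolding filterlim_at using Zlim Z e by (auto elim!: eventually_mono)
  have "filterlim Z (at e within cball 0 1) (at_right 0)"
    unfolding filterlim_at using Zlim Z e by (auto elim!: eventually_mono)
  moreover have "((\<lambda>z. (f z - f e) / (z - e)) \<longlongrightarrow> f' e) (at e within cball 0 1)"
    using deriv[of e] e by (simp add: has_field_derivative_iff)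
  ultimately have "((\<lambda>t. (f (Z t) - f e) / (Z t - e)) \<longlongrightarrow> f' e) (at_right 0)"
    using filterlim_compose by blast
  hence L1: "((\<lambda>t. inverse ((f (Z t) - f e) / (Z t - e))) \<longlongrightarrow> inverse (f' e)) (at_right 0)"
    using fe by (rule tendsto_inverse)
  \<comment> \<open>\<open>Ln (z / e)\<close> is the branch vanishing at \<open>e\<close>, and its
    real part at \<open>Z t\<close> is \<open>ln \<bar>Z t\<bar>\<close>. Since
    \<open>f (Z t) - f e = t * \<nu>\<close>, the quotient \<open>ln \<bar>Z t\<bar> / t\<close> is
    the real part of \<open>\<nu>\<close> times the ratio of the difference quotients of this branch
    and of \<open>f\<close>.\<close>
  have "((\<lambda>z. Ln (z / e)) has_field_derivative 1 / e) (at e)"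
    using e0 by (auto intro!: derivative_eq_intros)
  hence "((\<lambda>z. (Ln (z / e) - Ln (e / e)) / (z - e)) \<longlongrightarrow> 1 / e) (at e)"
    by (simp add: has_field_derivative_iff)
  hence L2: "((\<lambda>t. (Ln (Z t / e) - Ln (e / e)) / (Z t - e)) \<longlongrightarrow> 1 / e) (at_right 0)"
    using filt filterlim_compose by blast
  have "((\<lambda>t. Re (\<nu> * ((Ln (Z t / e) - Ln (e / e)) / (Z t - e) * inverse ((f (Z t) - f e) / (Z t - e)))))
      \<longlongrightarrow> Re (\<nu> * (1 / e * inverse (f' e)))) (at_right 0)"
    by (intro tendsto_intros L1 L2)
  moreover have "\<forall>\<^sub>F t in at_right 0.
      Re (\<nu> * ((Ln (Z t / e) - Ln (e / e)) / (Z t - e) * inverse ((f (Z t) - f e) / (Z t - e)))) = ln (norm (Z t)) / t"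
    using Z Z0
  proof eventually_elim
    case (elim t)
    have ne: "Z t - e \<noteq> 0" using elim e by auto
    have \<nu>0: "\<nu> \<noteq> 0" using near(1) by auto
    have "f (Z t) - f e = of_real t * \<nu>" using elim by simp
    hence "\<nu> * ((Ln (Z t / e) - Ln (e / e)) / (Z t - e) * inverse ((f (Z t) - f e) / (Z t - e)))
        = Ln (Z t / e) / of_real t"
      using ne \<nu>0 e0 elim by (simp add: field_simps)
    thus ?case using elim e e0 by (simp add: norm_divide)
  qed
  ultimately have "((\<lambda>t. ln (norm (Z t)) / t) \<longlongrightarrow> Re (\<nu> * (1 / e * inverse (f' e)))) (at_right 0)"
    by (rule Lim_transform_eventually)
  hence "((\<lambda>t. - (ln (norm (Z t)) / t) / (2 * pi)) \<longlongrightarrow> - Re (\<nu> * (1 / e * inverse (f' e))) / (2 * pi)) (at_right 0)"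
    by (intro tendsto_intros) auto
  hence dval: "d = - Re (\<nu> * (1 / e * inverse (f' e))) / (2 * pi)"
    using tendsto_unique[OF _ lnlim] by simp
  define s where "s = sqrt (1 + c\<^sup>2)"
  have s: "s > 0" by (auto simp: s_def add_pos_nonneg)
  \<comment> \<open>The tangent vector in chart coordinates, by \<open>tangent_slope\<close> a real
    multiple of \<open>Complex 1 c\<close>. The normal direction \<open>Complex (- c) 1\<close> is
    \<open>\<i>\<close> times \<open>Complex 1 c\<close>, so the quotient of \<open>\<nu>\<close> by
    \<open>f' e * e\<close> is real.\<close>
  define T where "T = cnj w * (f' e * (\<i> * e))"
  have w: "norm w = 1" using ch by (simp add: boundary_chart_def)
  have ww: "w * cnj w = 1" using w by (metis complex_norm_square of_real_1 power_one)
  have T: "T = of_real (Re T) * Complex 1 c"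
    using tangent_slope[OF ch cont \<gamma> e] by (simp add: T_def[symmetric] complex_eq_iff)
  have c1: "norm (Complex 1 c) = s" by (simp add: s_def cmod_def)
  have normT: "norm T = norm (f' e)" using w e by (simp add: T_def norm_mult)
  have fT: "f' e * e = - \<i> * (w * T)"
  proof -
    have "w * T = (w * cnj w) * (f' e * (\<i> * e))" by (simp add: T_def mult_ac)
    also have "\<dots> = f' e * (\<i> * e)" using ww by simp
    finally show ?thesis by (simp add: mult_ac)
  qed
  have T0: "Re T \<noteq> 0" using T fe normT by auto
  have c0: "Complex 1 c \<noteq> 0" by (simp add: complex_eq_iff)
  have w0: "w \<noteq> 0" using w by auto
  have "\<nu> * (1 / e * inverse (f' e)) = \<nu> / (f' e * e)" by (simp add: field_simps)
  also have "\<dots> = - 1 / of_real (s * Re T)"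
  proof -
    have "Complex (- c) 1 = \<i> * Complex 1 c" by (simp add: complex_eq_iff)
    thus ?thesis
      unfolding fT \<nu> s_def[symmetric] using s T0 c0 w0 by (subst T) (simp add: field_simps)
  qed
  also have "\<dots> = of_real (- 1 / (s * Re T))" by simp
  finally have "Re (\<nu> * (1 / e * inverse (f' e))) = - 1 / (s * Re T)" by (metis Re_complex_of_real)
  hence dd: "d = 1 / (2 * pi * (s * Re T))" using dval by simp
  \<comment> \<open>Negative \<open>Re T\<close> would mean a curve with the domain on its right,
    and would contradict \<open>d > 0\<close>.\<close>
  have "Re T > 0"
  proof (rule ccontr)
    assume "\<not> Re T > 0"
    hence "2 * pi * (s * Re T) \<le> 0" using s by (intro mult_nonneg_nonpos) auto
    hence "d \<le> 0" unfolding dd by (rule divide_nonneg_nonpos[rotated]) simp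
    thus False using d by simp
  qed
  moreover have "norm T = \<bar>Re T\<bar> * s" by (subst T) (simp add: norm_mult c1)
  ultimately have "norm (f' e) = s * Re T" using normT by simp
  thus "d = 1 / (2 * pi * norm (f' e))" using dd by simp
qed

end

section \<open>Stability of a conformal map in terms of the modulus of its derivative\<close>

text \<open>The bounds place \<open>a\<close> and \<open>b\<close> in the half-plane
  \<open>Re z \<le> ln M\<close>, which is convex and on which the derivative of \<open>exp\<close>
  has modulus at most \<open>M\<close>.\<close>

lemma cmod_exp_diff_le:
  assumes "norm (exp a) \<le> M" "norm (exp b) \<le> M" "0 < M"
  shows "norm (exp a - exp b) \<le> M * norm (a - b :: complex)"
proof (rule field_differentiable_bound[where f = exp and f' = exp and S = "{z. Re z \<le> ln M}"])
  show "convex {z. Re z \<le> ln M}" by (rule convex_halfspace_Re_le)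
  show "norm (exp z) \<le> M" if "z \<in> {z. Re z \<le> ln M}" for z
    using that assms(3) by (simp add: ln_ge_iff)
qed (use assms in \<open>auto simp: ln_ge_iff intro!: derivative_eq_intros\<close>)

text \<open>Borel--Caratheodory at the level of the derivative: \<open>(G - G z) / (4 \<epsilon> - (G - G z))\<close>
  maps into the closed unit disc.\<close>

lemma deriv_bound_of_Re_bound:
  assumes G: "G holomorphic_on ball 0 1" and Re: "\<And>z. z \<in> ball 0 1 \<Longrightarrow> \<bar>Re (G z)\<bar> \<le> \<epsilon>"
    and z: "z \<in> ball 0 1"
  shows "norm (deriv G z) \<le> 8 * \<epsilon> / (1 - norm z)"
proof -
  \<comment> \<open>Cauchy's inequality is used on the disc reaching half way to the circle, which
    turns the factor \<open>4\<close> into \<open>8\<close>.\<close>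
  define r where "r = (1 - norm z) / 2"
  have r: "0 < r" and sub: "cball z r \<subseteq> ball 0 1"
    using z by (auto simp: r_def cball_subset_ball_iff field_simps)
  \<comment> \<open>Working with \<open>e > \<epsilon>\<close> covers the case
    \<open>\<epsilon> = 0\<close>, in which the denominator of \<open>H\<close> would vanish at
    \<open>z\<close>. Letting \<open>e\<close> tend to \<open>\<epsilon>\<close> recovers the
    bound.\<close>
  have main: "norm (deriv G z) \<le> 4 * e / r" if e: "e > \<epsilon>" for e
  proof -
    have "0 \<le> \<epsilon>" using Re[OF z] by linarith
    with e have epos: "e > 0" by simp
    define H where "H w = (G w - G z) / (4 * of_real e - (G w - G z))" for w
    have Rb: "Re (G w - G z) < 2 * e" if "w \<in> ball 0 1" for w
      using Re[OF that] Re[OF z] e by auto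
    have nz: "4 * of_real e - (G w - G z) \<noteq> 0" if "w \<in> ball 0 1" for w
      using Rb[OF that] epos by (auto simp: complex_eq_iff)
    have H1: "norm (H w) \<le> 1" if "w \<in> ball 0 1" for w
    proof -
      have "norm (G w - G z) \<le> norm (4 * of_real e - (G w - G z))"
      proof (rule power2_le_imp_le)
        \<comment> \<open>For \<open>v = G w - G z\<close> this quantity is exactly
          \<open>\<bar>4 * e - v\<bar>\<^sup>2 - \<bar>v\<bar>\<^sup>2\<close>.\<close>
        have "0 \<le> 8 * e * (2 * e - Re (G w - G z))" using Rb[OF that] epos by simp
        thus "(norm (G w - G z))\<^sup>2 \<le> (norm (4 * of_real e - (G w - G z)))\<^sup>2"
          unfolding cmod_power2 by (simp add: power2_eq_square algebra_simps)
      qed simp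
      thus ?thesis using nz[OF that] by (simp add: H_def norm_divide divide_le_eq)
    qed
    have holH: "H holomorphic_on ball 0 1"
      unfolding H_def using nz by (intro holomorphic_intros G) auto
    have "norm ((deriv ^^ 1) H z) \<le> fact 1 * 1 / r ^ 1"
    proof (rule Cauchy_inequality)
      show "H holomorphic_on ball z r"
        using holH sub by (meson ball_subset_cball holomorphic_on_subset order_trans)
      show "continuous_on (cball z r) H"
        using holH sub by (meson holomorphic_on_imp_continuous_on continuous_on_subset)
      show "norm (H x) \<le> 1" if "norm (z - x) = r" for x
        using that sub by (intro H1) (auto simp: dist_norm)
    qed (use r in auto)
    hence 1: "norm (deriv H z) \<le> 1 / r" by simp
    have dG: "(G has_field_derivative deriv G z) (at z)"
      using G z holomorphic_derivI by blast
    have "(H has_field_derivative (deriv G z / (4 * of_real e))) (at z)"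
      unfolding H_def using epos
      by (auto intro!: derivative_eq_intros dG simp: power2_eq_square)
    hence "deriv H z = deriv G z / (4 * of_real e)" by (rule DERIV_imp_deriv)
    with 1 epos show ?thesis
      by (simp add: norm_divide divide_simps mult_ac split: if_splits)
  qed
  have "norm (deriv G z) \<le> 4 * \<epsilon> / r"
  proof (rule field_le_epsilon)
    fix d :: real assume d: "d > 0"
    show "norm (deriv G z) \<le> 4 * \<epsilon> / r + d"
      using main[of "\<epsilon> + d * r / 4"] d r by (simp add: field_simps)
  qed
  thus ?thesis using z by (simp add: r_def)
qed

lemma has_vector_derivative_radial:
  assumes "(G has_field_derivative g) (at (of_real t * z :: complex))"
  shows "((\<lambda>t. G (of_real t * z)) has_vector_derivative z * g) (at t)"
proof -
  have "((\<lambda>t. of_real t * z) has_vector_derivative z) (at t)"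
    by (auto simp: has_vector_derivative_def scaleR_conv_of_real intro!: derivative_eq_intros)
  from field_vector_diff_chain_at[OF this assms] show ?thesis by (simp add: o_def)
qed

text \<open>The derivative bound of order \<open>1 / (1 - \<bar>z\<bar>)\<close> is integrated along
  the radius. The logarithm this yields is replaced by a cruder inverse square root, which has a
  simple primitive and is still integrable up to the circle, as the next integration
  requires.\<close>

lemma norm_bound_of_Re_bound:
  assumes G: "G holomorphic_on ball 0 1" and Re: "\<And>z. z \<in> ball 0 1 \<Longrightarrow> \<bar>Re (G z)\<bar> \<le> \<epsilon>"
    and z: "z \<in> ball 0 1"
  shows "norm (G z - G 0) \<le> 16 * \<epsilon> / sqrt (1 - norm z)"
proof -
  have \<epsilon>: "0 \<le> \<epsilon>" using Re[OF z] by linarith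
  define r where "r = norm z"
  have r: "r < 1" "0 \<le> r" using z by (auto simp: r_def)
  define F where "F t = G (of_real t * z)" for t :: real
  have tz: "of_real t * z \<in> ball 0 1" if "0 \<le> t" "t \<le> 1" for t
    using that r mult_le_one[of t r] mult_right_mono[of t 1 r] by (simp add: norm_mult r_def)
  have rt: "r * t < 1" if "0 \<le> t" "t \<le> 1" for t
    using that r mult_left_mono[of t 1 r] by simp
  have dF: "(F has_vector_derivative z * deriv G (of_real t * z)) (at t)" if "0 \<le> t" "t \<le> 1" for t
    unfolding F_def using has_vector_derivative_radial holomorphic_derivI[OF G open_ball tz[OF that]] .
  have "norm (F 1 - F 0) \<le> 16 * \<epsilon> / sqrt (1 - r * 1) - 16 * \<epsilon> / sqrt (1 - r * 0)"
  proof (rule differentiable_bound_general[where \<phi> = "\<lambda>t. 16 * \<epsilon> / sqrt (1 - r * t)"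
        and \<phi>' = "\<lambda>t. 8 * \<epsilon> * r / (sqrt (1 - r * t) * (1 - r * t))" and f = F
        and f' = "\<lambda>t. z * deriv G (of_real t * z)"])
    show "continuous_on {0..1} F"
      by (rule continuous_at_imp_continuous_on)
        (auto intro: has_vector_derivative_continuous[OF dF])
    show "continuous_on {0..1} (\<lambda>t. 16 * \<epsilon> / sqrt (1 - r * t))"
      using rt by (intro continuous_intros) (auto, force)
    fix t :: real assume t: "0 < t" "t < 1"
    have rt': "r * t < 1" using rt t by simp
    show "(F has_vector_derivative z * deriv G (of_real t * z)) (at t)" using dF t by simp
    have "((\<lambda>t. 16 * \<epsilon> / sqrt (1 - r * t)) has_real_derivative
        8 * \<epsilon> * r / (sqrt (1 - r * t) * (1 - r * t))) (at t)"
      using rt' by (auto intro!: derivative_eq_intros simp: field_simps)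
    thus "((\<lambda>t. 16 * \<epsilon> / sqrt (1 - r * t)) has_vector_derivative
        8 * \<epsilon> * r / (sqrt (1 - r * t) * (1 - r * t))) (at t)"
      by (simp add: has_real_derivative_iff_has_vector_derivative)
    have n: "norm (of_real t * z) = r * t" using t by (simp add: norm_mult r_def)
    have "norm (z * deriv G (of_real t * z)) \<le> r * (8 * \<epsilon> / (1 - r * t))"
      using deriv_bound_of_Re_bound[OF G Re tz, of t] t r n
      unfolding norm_mult n r_def[symmetric] by (intro mult_left_mono) (auto simp: mult.commute)
    \<comment> \<open>The inserted \<open>1\<close> is then replaced by the smaller
      \<open>sqrt (1 - r * t)\<close>, which makes the majorant the exact derivative of
      \<open>16 * \<epsilon> / sqrt (1 - r * t)\<close>.\<close>
    also have "\<dots> = 8 * \<epsilon> * r / (1 * (1 - r * t))" by simp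
    also have "\<dots> \<le> 8 * \<epsilon> * r / (sqrt (1 - r * t) * (1 - r * t))"
      using \<epsilon> r rt' t by (intro divide_left_mono mult_right_mono mult_pos_pos) auto
    finally show "norm (z * deriv G (of_real t * z)) \<le> \<dots>" .
  qed simp
  also have "\<dots> \<le> 16 * \<epsilon> / sqrt (1 - r)" using \<epsilon> by simp
  finally show ?thesis by (simp add: F_def r_def)
qed


text \<open>The maximum modulus principle for both quotients carries the boundary comparison of
  \<open>\<bar>g1\<bar>\<close> and \<open>\<bar>g2\<bar>\<close> into the disc and bounds the real
  part of a logarithm of \<open>g1 / g2\<close>. This controls \<open>cis \<beta> * g1 - g2\<close>
  with an integrable singularity at the circle, and integration starts from the common value
  \<open>c\<close>.\<close>

lemma conformal_distance_le:
  fixes f1 f2 g1 g2 :: "complex \<Rightarrow> complex"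
  assumes f: "\<And>z. z \<in> cball 0 1 \<Longrightarrow> (f1 has_field_derivative g1 z) (at z within cball 0 1)"
      "\<And>z. z \<in> cball 0 1 \<Longrightarrow> (f2 has_field_derivative g2 z) (at z within cball 0 1)"
    and cont: "continuous_on (cball 0 1) g1" "continuous_on (cball 0 1) g2"
    and nz: "\<And>z. z \<in> cball 0 1 \<Longrightarrow> g1 z \<noteq> 0" "\<And>z. z \<in> cball 0 1 \<Longrightarrow> g2 z \<noteq> 0"
    and R: "\<And>z. norm z = 1 \<Longrightarrow> norm (g1 z) \<le> R" "\<And>z. norm z = 1 \<Longrightarrow> norm (g2 z) \<le> R"
    and ratio: "\<And>z. norm z = 1 \<Longrightarrow> norm (g1 z) \<le> exp \<epsilon> * norm (g2 z)"
      "\<And>z. norm z = 1 \<Longrightarrow> norm (g2 z) \<le> exp \<epsilon> * norm (g1 z)"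
    and eq0: "f1 0 = c" "f2 0 = c"
  obtains \<beta> where "\<And>z. z \<in> ball 0 1 \<Longrightarrow> norm (rotate_about c \<beta> (f1 z) - f2 z) \<le> 33 * R * \<epsilon>"
proof -
  have f': "(f1 has_field_derivative g1 z) (at z)" "(f2 has_field_derivative g2 z) (at z)"
    if "z \<in> ball 0 1" for z
    using f[of z] that at_within_interior[of z "cball 0 1"] by auto
  have holf: "f1 holomorphic_on ball 0 1" "f2 holomorphic_on ball 0 1"
    unfolding holomorphic_on_open[OF open_ball] using f' by blast+
  have "deriv f1 holomorphic_on ball 0 1" "deriv f2 holomorphic_on ball 0 1"
    using holf by (auto intro: holomorphic_deriv)
  hence holg: "g1 holomorphic_on ball 0 1" "g2 holomorphic_on ball 0 1"
    using holomorphic_transform[of "deriv f1" _ g1] holomorphic_transform[of "deriv f2" _ g2]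
      DERIV_imp_deriv f' by blast+
  have mm: "norm (h z) \<le> B" if "h holomorphic_on ball 0 1" "continuous_on (cball 0 1) h"
    "\<And>z. norm z = 1 \<Longrightarrow> norm (h z) \<le> B" "z \<in> ball 0 1" for h :: "complex \<Rightarrow> complex" and B z
    by (rule maximum_modulus_frontier[of h "cball 0 1" B z]) (use that in auto)
  have Rpos: "R > 0" using R(1)[of 1] nz(1)[of 1] by (auto intro: less_le_trans[of _ "norm (g1 1)"])
  define q where "q z = g1 z / g2 z" for z
  have holq: "q holomorphic_on ball 0 1"
    unfolding q_def using nz holg by (intro holomorphic_intros) auto
  have q1: "norm (q z) \<le> exp \<epsilon>" if "z \<in> ball 0 1" for z
  proof (rule mm[OF holq _ _ that])
    show "continuous_on (cball 0 1) q" unfolding q_def using nz cont by (intro continuous_intros) auto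
    show "norm (q z) \<le> exp \<epsilon>" if "norm z = 1" for z
      using ratio(1)[OF that] nz(2)[of z] that by (simp add: q_def norm_divide divide_le_eq)
  qed
  have q2: "norm (g2 z / g1 z) \<le> exp \<epsilon>" if "z \<in> ball 0 1" for z
  proof (rule mm[OF _ _ _ that])
    show "(\<lambda>z. g2 z / g1 z) holomorphic_on ball 0 1"
      using nz holg by (intro holomorphic_intros) auto
    show "continuous_on (cball 0 1) (\<lambda>z. g2 z / g1 z)" using nz cont by (intro continuous_intros) auto
    show "norm (g2 z / g1 z) \<le> exp \<epsilon>" if "norm z = 1" for z
      using ratio(2)[OF that] nz(1)[of z] that by (simp add: norm_divide divide_le_eq)
  qed
  have gR: "norm (g1 z) \<le> R" "norm (g2 z) \<le> R" if "z \<in> ball 0 1" for z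
    using mm[OF holg(1) cont(1) R(1) that] mm[OF holg(2) cont(2) R(2) that] by auto
  obtain G where G: "G holomorphic_on ball 0 1" "\<And>z. z \<in> ball 0 1 \<Longrightarrow> q z = exp (G z)"
  proof (rule contractible_imp_holomorphic_log[OF holq])
    show "contractible (ball (0::complex) 1)" by (intro convex_imp_contractible convex_ball)
    show "q z \<noteq> 0" if "z \<in> ball 0 1" for z using nz[of z] that by (auto simp: q_def)
  qed blast
  have Re: "\<bar>Re (G z)\<bar> \<le> \<epsilon>" if "z \<in> ball 0 1" for z
  proof -
    have "exp (Re (G z)) \<le> exp \<epsilon>" using q1[OF that] G(2)[OF that] by simp
    moreover have "exp (- Re (G z)) \<le> exp \<epsilon>"
    proof -
      have "norm (inverse (q z)) \<le> exp \<epsilon>" using q2[OF that] by (simp add: q_def)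
      thus ?thesis using G(2)[OF that] by (simp add: norm_inverse exp_minus)
    qed
    ultimately show ?thesis by simp
  qed
  have \<epsilon>: "0 \<le> \<epsilon>" using Re[of 0] by simp
  \<comment> \<open>Rotating \<open>f1\<close> about \<open>c\<close> multiplies its derivative by
    \<open>cis \<beta>\<close>. This \<open>\<beta>\<close> cancels the argument of
    \<open>g1 0 / g2 0\<close>, so that \<open>E\<close> is real at \<open>0\<close> and no
    uncontrolled imaginary constant remains.\<close>
  define \<beta> where "\<beta> = - Im (G 0)"
  define E where "E z = G z - \<i> * of_real (Im (G 0))" for z
  have expE: "exp (E z) * g2 z = cis \<beta> * g1 z" if "z \<in> ball 0 1" for z
  proof -
    have "exp (E z) = q z * cis \<beta>"
      using G(2)[OF that] by (simp add: E_def \<beta>_def exp_diff cis_conv_exp exp_minus field_simps)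
    thus ?thesis using nz(2)[of z] that by (simp add: q_def)
  qed
  have Ebound: "norm (E z) \<le> \<epsilon> * (1 + 16 / sqrt (1 - norm z))" if "z \<in> ball 0 1" for z
  proof -
    have "E z = (G z - G 0) + of_real (Re (G 0))"
      by (simp add: E_def complex_eq_iff)
    hence "norm (E z) \<le> norm (G z - G 0) + \<bar>Re (G 0)\<bar>"
      by (metis norm_of_real norm_triangle_ineq)
    thus ?thesis
      using norm_bound_of_Re_bound[OF G(1) Re that] Re[of 0] by (simp add: algebra_simps)
  qed
  have db: "norm (cis \<beta> * g1 z - g2 z) \<le> R * \<epsilon> * (1 + 16 / sqrt (1 - norm z))" if "z \<in> ball 0 1" for z
  proof -
    have g2: "g2 z \<noteq> 0" using nz(2)[of z] that by simp
    \<comment> \<open>Both terms become exponentials of numbers differing by \<open>E z\<close>,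
      with \<open>Ln (g2 z)\<close> as common reference, so that the Lipschitz bound for
      \<open>exp\<close> applies.\<close>
    have "cis \<beta> * g1 z - g2 z = exp (E z + Ln (g2 z)) - exp (Ln (g2 z))"
      using expE[OF that] g2 by (simp add: exp_add)
    also have "norm \<dots> \<le> R * norm (E z + Ln (g2 z) - Ln (g2 z))"
    proof (rule cmod_exp_diff_le)
      have "exp (E z + Ln (g2 z)) = cis \<beta> * g1 z" using expE[OF that] g2 by (simp add: exp_add)
      thus "norm (exp (E z + Ln (g2 z))) \<le> R" using gR(1)[OF that] by (simp add: norm_mult)
      show "norm (exp (Ln (g2 z))) \<le> R" using gR(2)[OF that] g2 by simp
    qed (use Rpos in auto)
    also have "\<dots> \<le> R * (\<epsilon> * (1 + 16 / sqrt (1 - norm z)))"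
      using Ebound[OF that] Rpos by (intro mult_left_mono) auto
    finally show ?thesis by (simp add: mult_ac)
  qed
  show thesis
  proof (rule that[of \<beta>])
    fix z :: complex assume z: "z \<in> ball 0 1"
    define h where "h w = rotate_about c \<beta> (f1 w) - f2 w" for w
    have tz: "norm (of_real t * z) \<le> t" "of_real t * z \<in> ball 0 1" if "0 \<le> t" "t \<le> 1" for t
      using that z mult_left_mono[of "norm z" 1 t] mult_right_mono[of t 1 "norm z"]
      by (auto simp: norm_mult)
    have dh: "((\<lambda>t. h (of_real t * z)) has_vector_derivative
        z * (cis \<beta> * g1 (of_real t * z) - g2 (of_real t * z))) (at t)" if "0 \<le> t" "t \<le> 1" for t
    proof -
      have "(h has_field_derivative cis \<beta> * g1 (of_real t * z) - g2 (of_real t * z)) (at (of_real t * z))"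
        unfolding h_def rotate_about_def
        by (auto intro!: derivative_eq_intros f' tz(2)[OF that])
      thus ?thesis by (rule has_vector_derivative_radial)
    qed
    \<comment> \<open>A primitive of the derivative bound, continuous up to \<open>t = 1\<close>
      although the bound blows up there. Its total increase is
      \<open>R * \<epsilon> * (1 + 32)\<close>.\<close>
    define \<Phi> where "\<Phi> t = R * \<epsilon> * (t - 32 * sqrt (1 - t))" for t
    have "norm (h (of_real 1 * z) - h (of_real 0 * z)) \<le> \<Phi> 1 - \<Phi> 0"
    proof (rule differentiable_bound_general[where \<phi> = \<Phi>
          and \<phi>' = "\<lambda>t. R * \<epsilon> * (1 + 16 / sqrt (1 - t))" and f = "\<lambda>t. h (of_real t * z)"
          and f' = "\<lambda>t. z * (cis \<beta> * g1 (of_real t * z) - g2 (of_real t * z))"])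
      show "continuous_on {0..1} (\<lambda>t. h (of_real t * z))"
        by (rule continuous_at_imp_continuous_on)
        (auto intro: has_vector_derivative_continuous[OF dh])
      show "continuous_on {0..1} \<Phi>" unfolding \<Phi>_def by (intro continuous_intros)
      fix t :: real assume t: "0 < t" "t < 1"
      show "((\<lambda>t. h (of_real t * z)) has_vector_derivative
        z * (cis \<beta> * g1 (of_real t * z) - g2 (of_real t * z))) (at t)" using dh t by simp
      have "(\<Phi> has_real_derivative R * \<epsilon> * (1 + 16 / sqrt (1 - t))) (at t)"
        unfolding \<Phi>_def using t by (auto intro!: derivative_eq_intros simp: field_simps)
      thus "(\<Phi> has_vector_derivative R * \<epsilon> * (1 + 16 / sqrt (1 - t))) (at t)"
        by (simp add: has_real_derivative_iff_has_vector_derivative)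
      have t': "of_real t * z \<in> ball 0 1" "norm (of_real t * z) \<le> t" using tz t by auto
      have "norm (z * (cis \<beta> * g1 (of_real t * z) - g2 (of_real t * z)))
          \<le> 1 * (R * \<epsilon> * (1 + 16 / sqrt (1 - norm (of_real t * z))))"
        unfolding norm_mult[of z] using z by (intro mult_mono db[OF t'(1)]) auto
      also have "\<dots> \<le> R * \<epsilon> * (1 + 16 / sqrt (1 - t))"
        unfolding mult_1_left using t t'(2) Rpos \<epsilon>
        by (intro mult_left_mono add_left_mono divide_left_mono) auto
      finally show "norm (z * (cis \<beta> * g1 (of_real t * z) - g2 (of_real t * z))) \<le> \<dots>" .
    qed simp
    also have "\<dots> = 33 * R * \<epsilon>" by (simp add: \<Phi>_def)
    finally show "norm (rotate_about c \<beta> (f1 z) - f2 z) \<le> 33 * R * \<epsilon>"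
      using eq0 by (simp add: h_def rotate_about_def)
  qed
qed

section \<open>Comparison of the arclength profiles\<close>

text \<open>By the mean value theorem. It serves to turn closeness of two values of a primitive into
  closeness of the arguments.\<close>

lemma deriv_lower_bound_imp_expanding:
  fixes F :: "real \<Rightarrow> real"
  assumes F: "\<And>x. x \<in> {0..L} \<Longrightarrow> (F has_real_derivative F' x) (at x within {0..L})"
    and m: "\<And>x. x \<in> {0..L} \<Longrightarrow> m \<le> F' x" and "0 \<le> m" and xy: "x \<in> {0..L}" "y \<in> {0..L}"
  shows "m * \<bar>x - y\<bar> \<le> \<bar>F x - F y\<bar>"
proof -
  have *: "m * (x - y) \<le> F x - F y" if "y \<le> x" "x \<in> {0..L}" "y \<in> {0..L}" for x y
  proof -
    have "\<exists>z\<in>{y..x}. F x - F y = F' z * (x - y)"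
    proof (rule mvt_very_simple[OF that(1)])
      fix z assume z: "y \<le> z" "z \<le> x"
      show "(F has_derivative (*) (F' z)) (at z within {y..x})"
        using F[of z] z that unfolding has_field_derivative_def
        by (rule_tac has_derivative_subset) auto
    qed
    then obtain z where "z \<in> {y..x}" "F x - F y = F' z * (x - y)" by blast
    thus ?thesis using m[of z] that by (auto intro: mult_right_mono)
  qed
  show ?thesis
  proof (cases "y \<le> x")
    case True
    thus ?thesis using *[OF True xy] by auto
  next
    case False
    thus ?thesis using *[of x y] xy by auto
  qed
qed

text \<open>Rescaled to the common interval \<open>[0, L]\<close>, the primitives differ by a
  multiple of \<open>D\<close>, and their values at the images of \<open>a\<close> and
  \<open>b\<close> by a multiple of \<open>\<bar>L1 - L2\<bar>\<close>. As the first grows at rate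
  at least \<open>m\<close>, these images \<open>\<sigma>\<close> and \<open>\<tau>\<close> are
  close, and the Lipschitz bound on \<open>\<phi>1\<close> then compares the profiles.\<close>

lemma profile_comparison:
  fixes \<phi>1 \<phi>2 F1 F2 :: "real \<Rightarrow> real"
  assumes F1: "\<And>x. x \<in> {0..L1} \<Longrightarrow> (F1 has_real_derivative \<phi>1 x) (at x within {0..L1})"
    and F2: "\<And>x. x \<in> {0..L2} \<Longrightarrow> (F2 has_real_derivative \<phi>2 x) (at x within {0..L2})"
    and F0: "F1 0 = 0" "F2 0 = 0" and ab: "a \<in> {0..L1}" "b \<in> {0..L2}" "F1 a = \<kappa>" "F2 b = \<kappa>"
    and \<kappa>: "0 \<le> \<kappa>" "\<kappa> \<le> 1" and m: "0 < m" "\<And>x. x \<in> {0..L1} \<Longrightarrow> m \<le> \<phi>1 x"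
    and L: "0 < p" "p \<le> L1" "p \<le> L2" "L1 \<le> P" "L2 \<le> P" "L = (L1 + L2) / 2"
    and D: "\<And>x. x \<in> {0..L} \<Longrightarrow> \<bar>\<phi>1 (L1 / L * x) - \<phi>2 (L2 / L * x)\<bar> \<le> D"
    and lip: "\<And>x y. x \<in> {0..L1} \<Longrightarrow> y \<in> {0..L1} \<Longrightarrow> \<bar>\<phi>1 x - \<phi>1 y\<bar> \<le> M * \<bar>x - y\<bar>" and "0 \<le> M"
  shows "\<bar>\<phi>1 a - \<phi>2 b\<bar> \<le> (1 + 2 * M * (P / m + P / (p\<^sup>2 * m))) * (D + \<bar>L1 - L2\<bar>)"
proof -
  have pos: "L1 > 0" "L2 > 0" "L > 0" "P > 0" "L \<le> P" "p \<le> L" using L by auto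
  have D0: "D \<ge> 0" using D[of 0] pos by auto
  have scale: "l / L * x \<in> {0..l}" if "x \<in> {0..L}" "l > 0" for l x
    using that pos mult_left_mono[of x L "l / L"] by auto
  have unscale: "L / l * x \<in> {0..L}" if "x \<in> {0..l}" "l > 0" for l x
    using that pos mult_left_mono[of x l "L / l"] by auto
  define \<sigma> where "\<sigma> = L / L1 * a"
  define \<tau> where "\<tau> = L / L2 * b"
  have \<sigma>: "\<sigma> \<in> {0..L}" "L1 / L * \<sigma> = a" and \<tau>: "\<tau> \<in> {0..L}" "L2 / L * \<tau> = b"
    unfolding \<sigma>_def \<tau>_def
    by (rule unscale[OF ab(1) pos(1)], use pos in simp, rule unscale[OF ab(2) pos(2)], use pos in simp)
  \<comment> \<open>The outer factor cancels the inner derivative, so \<open>H1\<close> has exactly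
    the rescaled profile as derivative. In exchange the common value \<open>\<kappa>\<close> becomes
    \<open>L / L1 * \<kappa>\<close> for one domain and \<open>L / L2 * \<kappa>\<close> for the
    other.\<close>
  define H1 where "H1 x = L / L1 * F1 (L1 / L * x)" for x
  define H2 where "H2 x = L / L2 * F2 (L2 / L * x)" for x
  have rescaled: "((\<lambda>x. L / l * F (l / L * x)) has_real_derivative \<phi> (l / L * x)) (at x within {0..L})"
    if F: "\<And>x. x \<in> {0..l} \<Longrightarrow> (F has_real_derivative \<phi> x) (at x within {0..l})" and "l > 0" "x \<in> {0..L}"
    for F \<phi> l x
  proof -
    have "(F has_real_derivative \<phi> (l / L * x)) (at (l / L * x) within (\<lambda>x. l / L * x) ` {0..L})"
      using F[OF scale[OF that(3,2)]] scale[OF _ that(2)] by (auto intro: has_field_derivative_subset)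
    moreover have "((\<lambda>x. l / L * x) has_real_derivative l / L) (at x within {0..L})"
      by (rule DERIV_cmult_Id)
    ultimately have "((\<lambda>x. F (l / L * x)) has_real_derivative \<phi> (l / L * x) * (l / L)) (at x within {0..L})"
      unfolding o_def[symmetric] by (rule DERIV_image_chain[unfolded o_def[symmetric]])
    from DERIV_cmult[OF this, of "L / l"] show ?thesis using that pos by simp
  qed
  have H1: "(H1 has_real_derivative \<phi>1 (L1 / L * x)) (at x within {0..L})" if "x \<in> {0..L}" for x
    unfolding H1_def by (rule rescaled[OF F1 pos(1) that])
  have H2: "(H2 has_real_derivative \<phi>2 (L2 / L * x)) (at x within {0..L})" if "x \<in> {0..L}" for x
    unfolding H2_def by (rule rescaled[OF F2 pos(2) that])
  have "m * \<bar>\<sigma> - \<tau>\<bar> \<le> \<bar>H1 \<sigma> - H1 \<tau>\<bar>"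
    by (rule deriv_lower_bound_imp_expanding[OF H1 _ _ \<sigma>(1) \<tau>(1)]) (use m scale pos in auto)
  also have "H1 \<sigma> = L / L1 * \<kappa>" using \<sigma>(2) ab by (simp add: H1_def)
  also have "\<bar>L / L1 * \<kappa> - H1 \<tau>\<bar> \<le> \<bar>L / L1 * \<kappa> - L / L2 * \<kappa>\<bar> + \<bar>H1 \<tau> - H2 \<tau>\<bar>"
    using \<tau>(2) ab by (simp add: H2_def)
  also have "\<bar>H1 \<tau> - H2 \<tau>\<bar> \<le> P * D"
  proof -
    \<comment> \<open>\<open>H1 - H2\<close> vanishes at \<open>0\<close>, and its derivative has
      modulus at most \<open>D\<close> on an interval of length at most \<open>P\<close>.\<close>
    have "norm ((H1 \<tau> - H2 \<tau>) - (H1 0 - H2 0)) \<le> D * norm (\<tau> - 0)"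
    proof (rule field_differentiable_bound[of "{0..L}"])
      show "((\<lambda>x. H1 x - H2 x) has_real_derivative \<phi>1 (L1 / L * x) - \<phi>2 (L2 / L * x)) (at x within {0..L})"
        if "x \<in> {0..L}" for x by (intro derivative_intros H1 H2 that)
    qed (use D \<tau> pos in auto)
    also have "\<dots> \<le> D * P" using D0 \<tau>(1) pos by (intro mult_left_mono) auto
    finally show ?thesis using F0 by (simp add: H1_def H2_def mult.commute)
  qed
  also have "\<bar>L / L1 * \<kappa> - L / L2 * \<kappa>\<bar> \<le> P / p\<^sup>2 * \<bar>L1 - L2\<bar>"
  proof -
    have "L / L1 * \<kappa> - L / L2 * \<kappa> = (\<kappa> * L) * (L2 - L1) / (L1 * L2)"
      using pos by (simp add: field_simps)
    hence "\<bar>L / L1 * \<kappa> - L / L2 * \<kappa>\<bar> = (\<kappa> * L) * \<bar>L1 - L2\<bar> / (L1 * L2)"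
      using pos \<kappa> by (simp add: abs_mult abs_minus_commute)
    also have "\<dots> \<le> (1 * P) * \<bar>L1 - L2\<bar> / p\<^sup>2"
      unfolding power2_eq_square using \<kappa> L pos by (intro frac_le mult_mono) auto
    finally show ?thesis by simp
  qed
  finally have "m * \<bar>\<sigma> - \<tau>\<bar> \<le> P / p\<^sup>2 * \<bar>L1 - L2\<bar> + P * D" by simp
  hence st: "\<bar>\<sigma> - \<tau>\<bar> \<le> P / (p\<^sup>2 * m) * \<bar>L1 - L2\<bar> + P / m * D"
    using m(1) L(1) by (simp add: field_simps)
  have "\<bar>\<phi>1 a - \<phi>2 b\<bar> \<le> \<bar>\<phi>1 (L1 / L * \<sigma>) - \<phi>1 (L1 / L * \<tau>)\<bar> + \<bar>\<phi>1 (L1 / L * \<tau>) - \<phi>2 (L2 / L * \<tau>)\<bar>"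
    unfolding \<sigma>(2) \<tau>(2) by simp
  also have "\<bar>\<phi>1 (L1 / L * \<sigma>) - \<phi>1 (L1 / L * \<tau>)\<bar> \<le> M * \<bar>L1 / L * \<sigma> - L1 / L * \<tau>\<bar>"
    using scale \<sigma> \<tau> pos by (intro lip) auto
  also have "\<bar>L1 / L * \<sigma> - L1 / L * \<tau>\<bar> = L1 / L * \<bar>\<sigma> - \<tau>\<bar>"
    unfolding right_diff_distrib[symmetric] abs_mult using pos by simp
  \<comment> \<open>\<open>L1 / L \<le> 2\<close> because \<open>L\<close> is the mean of two
    positive lengths.\<close>
  also have "\<dots> \<le> 2 * \<bar>\<sigma> - \<tau>\<bar>" using pos L by (intro mult_right_mono) (auto simp: field_simps)
  also have "\<dots> \<le> 2 * (P / (p\<^sup>2 * m) * \<bar>L1 - L2\<bar> + P / m * D)" using st by simp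
  also have "\<bar>\<phi>1 (L1 / L * \<tau>) - \<phi>2 (L2 / L * \<tau>)\<bar> \<le> D" using D \<tau> by blast
  finally have 1: "\<bar>\<phi>1 a - \<phi>2 b\<bar> \<le> M * (2 * (P / (p\<^sup>2 * m) * \<bar>L1 - L2\<bar> + P / m * D)) + D"
    using \<open>0 \<le> M\<close> by (simp add: mult_left_mono)
  define A where "A = P / (p\<^sup>2 * m)"
  define B where "B = P / m"
  have AB: "A \<ge> 0" "B \<ge> 0" using pos m by (auto simp: A_def B_def)
  \<comment> \<open>These are exactly the terms by which the product in the claim exceeds the bound
    just obtained.\<close>
  have "0 \<le> 2 * M * (A * D + B * \<bar>L1 - L2\<bar>) + \<bar>L1 - L2\<bar>" using AB D0 \<open>0 \<le> M\<close> by simp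
  with 1[folded A_def B_def] show ?thesis
    unfolding A_def[symmetric] B_def[symmetric] by (simp add: algebra_simps)
qed

section \<open>Continuity and sup bounds from membership in the Hoelder classes\<close>

lemma holder_on_imp_continuous_on:
  assumes "holder_on \<alpha> S f" "0 < \<alpha>"
  shows "continuous_on S f"
proof -
  obtain C where C: "\<And>x y. x \<in> S \<Longrightarrow> y \<in> S \<Longrightarrow> dist (f x) (f y) \<le> C * dist x y powr \<alpha>"
    using assms(1) unfolding holder_on_def by blast
  show ?thesis
    unfolding continuous_on_def
  proof
    fix x assume x: "x \<in> S"
    have "((\<lambda>y. C * dist y x powr \<alpha>) \<longlongrightarrow> C * dist x x powr \<alpha>) (at x within S)"
      using assms(2) by (intro tendsto_intros) auto
    hence "((\<lambda>y. C * dist y x powr \<alpha>) \<longlongrightarrow> 0) (at x within S)" using assms(2) by simp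
    moreover have "\<forall>\<^sub>F y in at x within S. norm (dist (f y) (f x)) \<le> C * dist y x powr \<alpha>"
      using C x by (auto simp: eventually_at_filter)
    ultimately have "((\<lambda>y. dist (f y) (f x)) \<longlongrightarrow> 0) (at x within S)" by (rule Lim_null_comparison[rotated])
    thus "(f \<longlongrightarrow> f x) (at x within S)" using tendsto_dist_iff by blast
  qed
qed

lemma continuous_abs_le_sup_norm_on:
  assumes "continuous_on {0..l} \<phi>" "x \<in> {0..l}"
  shows "\<bar>\<phi> x\<bar> \<le> sup_norm_on {0..l} \<phi>"
proof -
  have "compact ((\<lambda>x. \<bar>\<phi> x\<bar>) ` {0..l})"
    using assms by (intro compact_continuous_image continuous_intros) auto
  hence "bdd_above ((\<lambda>x. \<bar>\<phi> x\<bar>) ` {0..l})" by (simp add: bounded_imp_bdd_above compact_imp_bounded)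
  thus ?thesis unfolding sup_norm_on_def using assms(2) by (rule cSUP_upper2) simp
qed

text \<open>Each sup norm is at most \<open>M1\<close> because all three summands of
  \<open>holder_norm 1\<close> are nonnegative.\<close>

lemma G1_D:
  assumes \<phi>: "\<phi> \<in> G1 \<alpha> m M0 M1 l" and "0 < \<alpha>" "0 < l"
  shows "m \<le> \<phi> s" and "(\<phi> has_real_derivative deriv \<phi> s) (at s)" and "continuous_on A \<phi>"
    and "continuous_on A (deriv \<phi>)"
    and "s \<in> {0..l} \<Longrightarrow> \<bar>\<phi> s\<bar> \<le> M1" and "s \<in> {0..l} \<Longrightarrow> \<bar>deriv \<phi> s\<bar> \<le> M1"
proof -
  show "m \<le> \<phi> s" using \<phi> by (simp add: G1_def G0_def)
  obtain f' where f': "\<And>x. (\<phi> has_real_derivative f' x) (at x)" "holder_on \<alpha> UNIV f'"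
    using \<phi> by (auto simp: G1_def C1_holder_on_def)
  have eq: "deriv \<phi> = f'" using f'(1) by (intro ext DERIV_imp_deriv)
  show d: "(\<phi> has_real_derivative deriv \<phi> s) (at s)" using f' eq by simp
  have c0: "continuous_on UNIV \<phi>" using f'(1) by (meson DERIV_continuous_on has_field_derivative_at_within)
  have c1: "continuous_on UNIV (deriv \<phi>)" unfolding eq using f'(2) assms(2) by (rule holder_on_imp_continuous_on)
  show c: "continuous_on A \<phi>" "continuous_on A (deriv \<phi>)" for A
    using c0 c1 continuous_on_subset by blast+
  have le: "\<bar>\<phi> s\<bar> \<le> sup_norm_on {0..l} \<phi>" "\<bar>deriv \<phi> s\<bar> \<le> sup_norm_on {0..l} (deriv \<phi>)"
    if "s \<in> {0..l}" for s
    using that c by (auto intro: continuous_abs_le_sup_norm_on)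
  have nn: "0 \<le> sup_norm_on {0..l} \<phi>" "0 \<le> sup_norm_on {0..l} (deriv \<phi>)"
    using le[of 0] \<open>0 < l\<close> by auto
  \<comment> \<open>A real \<open>SUP\<close> over an unbounded set is unspecified, so its sign
    needs an argument: the Hoelder constant bounds the quotients, and the pair \<open>(0, l)\<close>
    contributes a nonnegative one.\<close>
  have semi: "0 \<le> holder_seminorm 1 \<alpha> {0..l} \<phi>"
  proof -
    obtain C where C: "\<And>x y. dist (f' x) (f' y) \<le> C * dist x y powr \<alpha>"
      using f'(2) unfolding holder_on_def by blast
    define I where "I = {(x, y). x \<in> {0..l} \<and> y \<in> {0..l} \<and> x \<noteq> y}"
    define q where "q = (\<lambda>(x, y). \<bar>deriv \<phi> x - deriv \<phi> y\<bar> / \<bar>x - y\<bar> powr \<alpha>)"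
    have "bdd_above (q ` I)"
      using C unfolding eq by (intro bdd_aboveI2[of _ _ C]) (auto simp: I_def q_def eq dist_real_def divide_le_eq)
    moreover have "(0, l) \<in> I" using \<open>0 < l\<close> by (simp add: I_def)
    ultimately have "q (0, l) \<le> (SUP z\<in>I. q z)" by (intro cSUP_upper)
    moreover have "0 \<le> q (0, l)" by (simp add: q_def)
    moreover have "holder_seminorm 1 \<alpha> {0..l} \<phi> = (SUP z\<in>I. q z)"
      by (simp add: holder_seminorm_def I_def q_def)
    ultimately show ?thesis by linarith
  qed
  have "{..1} = {0, 1::nat}" by auto
  hence "holder_norm 1 \<alpha> {0..l} \<phi> =
      sup_norm_on {0..l} \<phi> + sup_norm_on {0..l} (deriv \<phi>) + holder_seminorm 1 \<alpha> {0..l} \<phi>"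
    by (simp add: holder_norm_def)
  moreover have "holder_norm 1 \<alpha> {0..l} \<phi> \<le> M1" using \<phi> by (simp add: G1_def)
  ultimately show "s \<in> {0..l} \<Longrightarrow> \<bar>\<phi> s\<bar> \<le> M1" "s \<in> {0..l} \<Longrightarrow> \<bar>deriv \<phi> s\<bar> \<le> M1"
    using le[of s] nn semi by auto
qed

section \<open>Arclength and the boundary profile of a conformal map\<close>

context C1_conformal_map
begin

text \<open>The definite description requires uniqueness of the derivative within the disc, which
  holds because every point of the closed disc is a limit point of it.\<close>

lemma disc_deriv_eq:
  assumes "z \<in> cball 0 1"
  shows "disc_deriv f z = f' z"
proof -
  have "z islimpt ball 0 1" using assms by (simp add: islimpt_ball)
  hence "z islimpt cball 0 1" by (rule islimpt_subset) auto
  hence "at z within cball 0 1 \<noteq> bot" by (simp add: trivial_limit_within)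
  thus ?thesis
    unfolding disc_deriv_def using deriv[OF assms] has_field_derivative_unique by blast
qed

lemma continuous_speed: "continuous_on A (\<lambda>\<theta>. norm (f' (cis \<theta>)))"
  by (intro continuous_on_norm continuous_on_compose2[OF cont_deriv]) (auto intro!: continuous_intros)

lemma arclength_eq: "arclength f \<theta> = integral {0..\<theta>} (\<lambda>t. norm (f' (cis t)))"
  by (simp add: arclength_def disc_deriv_eq)

lemma arclength_deriv:
  assumes "\<theta> \<in> {0..2 * pi}"
  shows "(arclength f has_real_derivative norm (f' (cis \<theta>))) (at \<theta> within {0..2 * pi})"
  unfolding arclength_eq[abs_def]
  by (rule integral_has_real_derivative[OF continuous_speed assms])

lemma arclength_range:
  assumes "\<theta> \<in> {0..2 * pi}"
  shows "arclength f \<theta> \<in> {0..perimeter f}"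
  using assms unfolding perimeter_def arclength_eq
  by (auto intro!: integral_nonneg integral_subset_le integrable_continuous_interval continuous_speed)

text \<open>This is the separable equation \<open>s' = 1 / (2\<pi> \<phi> s)\<close> in integrated
  form: by the chain rule the left side has constant derivative \<open>1 / (2\<pi>)\<close> in
  \<open>\<theta>\<close>.\<close>

lemma profile_integral:
  assumes \<phi>: "continuous_on {0..perimeter f} \<phi>" "\<And>s. s \<in> {0..perimeter f} \<Longrightarrow> 0 < \<phi> s"
    and speed: "\<And>\<theta>. \<theta> \<in> {0..2 * pi} \<Longrightarrow> norm (f' (cis \<theta>)) = 1 / (2 * pi * \<phi> (arclength f \<theta>))"
    and \<theta>: "\<theta> \<in> {0..2 * pi}"
  shows "integral {0..arclength f \<theta>} \<phi> = \<theta> / (2 * pi)"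
proof -
  define G where "G \<theta> = integral {0..arclength f \<theta>} \<phi> - \<theta> / (2 * pi)" for \<theta>
  have "\<exists>c. \<forall>\<theta>\<in>{0..2 * pi}. G \<theta> = c"
  proof (rule has_field_derivative_zero_constant)
    fix \<theta> assume \<theta>: "\<theta> \<in> {0..2 * pi}"
    have "((\<lambda>x. integral {0..x} \<phi>) has_real_derivative \<phi> (arclength f \<theta>))
        (at (arclength f \<theta>) within {0..perimeter f})"
      by (rule integral_has_real_derivative[OF \<phi>(1) arclength_range[OF \<theta>]])
    hence "((\<lambda>x. integral {0..x} \<phi>) has_real_derivative \<phi> (arclength f \<theta>))
        (at (arclength f \<theta>) within arclength f ` {0..2 * pi})"
      using arclength_range by (auto intro: has_field_derivative_subset)
    from DERIV_image_chain[OF this arclength_deriv[OF \<theta>]]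
    have "((\<lambda>\<theta>. integral {0..arclength f \<theta>} \<phi>) has_real_derivative 1 / (2 * pi)) (at \<theta> within {0..2 * pi})"
      using speed[OF \<theta>] \<phi>(2)[OF arclength_range[OF \<theta>]] by (simp add: o_def field_simps)
    thus "(G has_real_derivative 0) (at \<theta> within {0..2 * pi})"
      unfolding G_def by (auto intro!: derivative_eq_intros)
  qed simp
  hence "G \<theta> = G 0" using \<theta> by fastforce
  thus ?thesis by (simp add: G_def arclength_eq)
qed

end

lemma unit_circle_cis:
  assumes "norm z = 1"
  obtains \<theta> where "\<theta> \<in> {0..2 * pi}" "z = cis \<theta>"
  using that[of "Arg2pi z"] assms Arg2pi_eq[of z] Arg2pi_ge_0[of z] Arg2pi_lt_2pi[of z]
  by (simp add: cis_conv_exp)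

text \<open>The witness \<open>a\<close> is the arclength at \<open>\<theta>\<close>, recorded only
  through the integral of \<open>\<phi>\<close>. The value \<open>\<theta> / (2\<pi>)\<close> is the
  common parameter by which the boundary points of two domains are matched.\<close>

lemma conformal_map_profile:
  assumes f: "is_conformal_map \<alpha> U \<zeta>\<^sub>o \<zeta> f" and T: "is_T f \<phi>"
    and L: "L = perimeter f"
    and \<phi>: "\<phi> \<in> G1 \<alpha> m M0 M1 L" and "0 < \<alpha>" "0 < m" "0 < L"
  shows "\<exists>f'. C1_conformal_map f f' \<and> (\<forall>z\<in>cball 0 1. f' z \<noteq> 0) \<and>
    (\<forall>\<theta>\<in>{0..2 * pi}. \<exists>a\<in>{0..L}.
      norm (f' (cis \<theta>)) = 1 / (2 * pi * \<phi> a) \<and> integral {0..a} \<phi> = \<theta> / (2 * pi))"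
proof -
  obtain f' where f': "\<And>z. z \<in> cball 0 1 \<Longrightarrow> (f has_field_derivative f' z) (at z within cball 0 1)"
      "holder_on \<alpha> (cball 0 1) f'"
    using f unfolding is_conformal_map_def C1_holder_on_def by blast
  interpret C1_conformal_map f f'
    by standard (use f' f holder_on_imp_continuous_on[OF f'(2) \<open>0 < \<alpha>\<close>] in
      \<open>auto simp: is_conformal_map_def\<close>)
  note G1 = G1_D[OF \<phi> \<open>0 < \<alpha>\<close> \<open>0 < L\<close>]
  obtain u where u: "point_source_solution \<Omega> (f 0) u"
    and nd: "\<And>\<theta>. \<theta> \<in> {0..2 * pi} \<Longrightarrow>
      has_interior_normal_derivative u (\<phi> (arclength f \<theta>)) \<Omega> (f (cis \<theta>))"
    using T unfolding is_T_def by blast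
  have pos: "0 < \<phi> s" for s using G1(1)[of s] \<open>0 < m\<close> by linarith
  note nde = normal_derivative_eq[OF u _ nd pos]
  show ?thesis
  proof (intro exI[of _ f'] conjI ballI C1_conformal_map_axioms)
    show "f' z \<noteq> 0" if "z \<in> cball 0 1" for z
    proof (cases "norm z = 1")
      case True
      then obtain \<theta> where "\<theta> \<in> {0..2 * pi}" "z = cis \<theta>" using unit_circle_cis by blast
      thus ?thesis using nde(1)[OF norm_cis] by simp
    next
      case False
      thus ?thesis using deriv_nonzero_interior that by simp
    qed
    have speed: "norm (f' (cis \<theta>)) = 1 / (2 * pi * \<phi> (arclength f \<theta>))" if "\<theta> \<in> {0..2 * pi}" for \<theta>
      using nde(2)[OF norm_cis that] pos[of "arclength f \<theta>"] by (simp add: field_simps)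
    show "\<exists>a\<in>{0..L}. norm (f' (cis \<theta>)) = 1 / (2 * pi * \<phi> a) \<and> integral {0..a} \<phi> = \<theta> / (2 * pi)"
      if "\<theta> \<in> {0..2 * pi}" for \<theta>
      using speed[OF that] profile_integral[OF G1(3) pos speed that] arclength_range[OF that]
      unfolding L by blast
  qed
qed

section \<open>From pointwise to Hausdorff distance, and from linear to Hoelder bounds\<close>

lemma hausdorff_dist_image_le:
  assumes "A \<noteq> {}" "\<And>x. x \<in> A \<Longrightarrow> dist (F x) (G x) \<le> \<epsilon>"
  shows "hausdorff_dist (F ` A) (G ` A) \<le> \<epsilon>"
  unfolding hausdorff_dist_def
proof (rule max.boundedI)
  show "(SUP a\<in>F ` A. infdist a (G ` A)) \<le> \<epsilon>"
    using assms by (intro cSUP_least) (auto intro: infdist_le2)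
  show "(SUP b\<in>G ` A. infdist b (F ` A)) \<le> \<epsilon>"
    using assms by (intro cSUP_least) (auto intro: infdist_le2 simp: dist_commute)
qed

text \<open>Split \<open>x = x powr (1 - \<alpha>) * x powr \<alpha>\<close> and bound only the
  first factor.\<close>

lemma le_powr_of_bounded:
  fixes x :: real
  assumes "0 \<le> x" "x \<le> Q" "\<alpha> \<le> 1"
  shows "x \<le> Q powr (1 - \<alpha>) * x powr \<alpha>"
proof (cases "x = 0")
  case False
  have "x = x powr (1 - \<alpha>) * x powr \<alpha>" using False assms by (simp flip: powr_add)
  also have "\<dots> \<le> Q powr (1 - \<alpha>) * x powr \<alpha>" using assms by (intro mult_right_mono powr_mono2) auto
  finally show ?thesis .
qed simp

section \<open>Stability of the domain\<close>

theorem corollary3p6: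
  fixes \<alpha> m M1 p P :: real
  assumes "0 < \<alpha>" "\<alpha> < 1" "0 < m" "0 < M1" "0 < p" "p \<le> P"
  shows "\<exists>K::real. \<forall>M0>0. \<forall>\<zeta>\<^sub>o \<Omega>1 \<Omega>2 \<zeta>1 \<zeta>2 f1 f2 \<phi>1 \<phi>2 L1 L2 L \<psi>1 \<psi>2.
     C1_holder_domain \<alpha> \<Omega>1 \<and> C1_holder_domain \<alpha> \<Omega>2 \<and>
     \<zeta>\<^sub>o \<in> \<Omega>1 \<and> \<zeta>\<^sub>o \<in> \<Omega>2 \<and> \<zeta>1 \<in> frontier \<Omega>1 \<and> \<zeta>2 \<in> frontier \<Omega>2 \<and>
     is_conformal_map \<alpha> \<Omega>1 \<zeta>\<^sub>o \<zeta>1 f1 \<and> is_conformal_map \<alpha> \<Omega>2 \<zeta>\<^sub>o \<zeta>2 f2 \<and>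
     L1 = perimeter f1 \<and> L2 = perimeter f2 \<and>
     p \<le> L1 \<and> L1 \<le> P \<and> p \<le> L2 \<and> L2 \<le> P \<and>
     is_T f1 \<phi>1 \<and> is_T f2 \<phi>2 \<and>
     L = (L1 + L2) / 2 \<and>
     \<psi>1 = (\<lambda>s. \<phi>1 (L1 / L * s)) \<and> \<psi>2 = (\<lambda>s. \<phi>2 (L2 / L * s)) \<and>
     \<phi>1 \<in> G1 \<alpha> m M0 M1 L1 \<and> \<phi>2 \<in> G1 \<alpha> m M0 M1 L2
     \<longrightarrow> (\<exists>\<beta>. hausdorff_dist (rotate_about \<zeta>\<^sub>o \<beta> ` \<Omega>1) \<Omega>2
           \<le> K * ((sup_norm_on {0..L} (\<lambda>s. \<psi>1 s - \<psi>2 s) + \<bar>L1 - L2\<bar>) powr \<alpha>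
                   + sup_norm_on {0..L} (\<lambda>s. deriv \<psi>2 s - deriv \<psi>1 s)))"
proof -
  \<comment> \<open>\<open>C\<close> is the constant of \<open>profile_comparison\<close> with
    Lipschitz constant \<open>M1\<close>, and \<open>R\<close> bounds the derivatives on the circle
    because the profiles are at least \<open>m\<close>. In \<open>K\<close>, \<open>33\<close> comes
    from the radial integration, \<open>C / m\<close> from passing to logarithms, and the power from
    lowering the exponent to \<open>\<alpha>\<close>.\<close>
  define C where "C = 1 + 2 * M1 * (P / m + P / (p\<^sup>2 * m))"
  define R where "R = 1 / (2 * pi * m)"
  define K where "K = 33 * R * (C / m) * (2 * M1 + P) powr (1 - \<alpha>)"
  have C: "C \<ge> 0" and R: "R > 0" and K: "K \<ge> 0"
    using assms by (auto simp: C_def R_def K_def intro!: add_nonneg_nonneg mult_nonneg_nonneg divide_nonneg_nonneg)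
  show ?thesis
  proof (rule exI[of _ K], intro allI impI, elim conjE)
    fix M0 :: real and \<zeta>\<^sub>o \<Omega>1 \<Omega>2 \<zeta>1 \<zeta>2 f1 f2 \<phi>1 \<phi>2 L1 L2 L \<psi>1 \<psi>2
    assume map: "is_conformal_map \<alpha> \<Omega>1 \<zeta>\<^sub>o \<zeta>1 f1" "is_conformal_map \<alpha> \<Omega>2 \<zeta>\<^sub>o \<zeta>2 f2"
      and L12: "L1 = perimeter f1" "L2 = perimeter f2" "p \<le> L1" "L1 \<le> P" "p \<le> L2" "L2 \<le> P"
      and T: "is_T f1 \<phi>1" "is_T f2 \<phi>2" and L: "L = (L1 + L2) / 2"
      and \<psi>: "\<psi>1 = (\<lambda>s. \<phi>1 (L1 / L * s))" "\<psi>2 = (\<lambda>s. \<phi>2 (L2 / L * s))"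
      and \<phi>: "\<phi>1 \<in> G1 \<alpha> m M0 M1 L1" "\<phi>2 \<in> G1 \<alpha> m M0 M1 L2"
    have pos: "0 < L1" "0 < L2" "0 < L" using L12 assms L by auto
    note g1 = G1_D[OF \<phi>(1) \<open>0 < \<alpha>\<close> pos(1)] and g2 = G1_D[OF \<phi>(2) \<open>0 < \<alpha>\<close> pos(2)]
    define D where "D = sup_norm_on {0..L} (\<lambda>s. \<psi>1 s - \<psi>2 s)"
    define E where "E = sup_norm_on {0..L} (\<lambda>s. deriv \<psi>2 s - deriv \<psi>1 s)"
    define \<delta> where "\<delta> = D + \<bar>L1 - L2\<bar>"
    have scale: "l / L * x \<in> {0..l}" if "x \<in> {0..L}" "l > 0" for l x
      using that pos mult_left_mono[of x L "l / L"] by auto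
    have c\<psi>: "continuous_on {0..L} (\<lambda>s. \<psi>1 s - \<psi>2 s)"
      unfolding \<psi> by (intro continuous_on_diff continuous_on_compose2[OF g1(3)[of UNIV]]
          continuous_on_compose2[OF g2(3)[of UNIV]] continuous_intros) auto
    have D: "\<bar>\<phi>1 (L1 / L * x) - \<phi>2 (L2 / L * x)\<bar> \<le> D" if "x \<in> {0..L}" for x
      using continuous_abs_le_sup_norm_on[OF c\<psi> that] by (simp add: D_def \<psi>)
    have "0 \<le> D" using D[of 0] pos by auto
    \<comment> \<open>This makes \<open>\<delta>\<close> bounded, so that an estimate linear in
      \<open>\<delta>\<close> can be weakened to the exponent \<open>\<alpha>\<close>.\<close>
    have "D \<le> 2 * M1"
      unfolding D_def sup_norm_on_def
    proof (rule cSUP_least)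
      show "\<bar>\<psi>1 x - \<psi>2 x\<bar> \<le> 2 * M1" if "x \<in> {0..L}" for x
        using g1(5)[OF scale[OF that pos(1)]] g2(5)[OF scale[OF that pos(2)]] by (simp add: \<psi>)
    qed (use pos in auto)
    have \<delta>: "0 \<le> \<delta>" "\<delta> \<le> 2 * M1 + P"
      using \<open>0 \<le> D\<close> \<open>D \<le> 2 * M1\<close> L12 assms by (auto simp: \<delta>_def)
    \<comment> \<open>Continuity of the rescaled derivatives makes \<open>E\<close> the supremum of
      a bounded set of nonnegative numbers.\<close>
    have "0 \<le> E"
    proof -
      have d: "deriv (\<lambda>s. \<phi> (l / L * s)) = (\<lambda>s. deriv \<phi> (l / L * s) * (l / L))"
        if "\<And>s. (\<phi> has_real_derivative deriv \<phi> s) (at s)" for \<phi> l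
        by (intro ext DERIV_imp_deriv DERIV_chain2[OF that] DERIV_cmult_Id)
      have "continuous_on {0..L} (\<lambda>s. deriv \<psi>2 s - deriv \<psi>1 s)"
        unfolding \<psi> d[OF g1(2)] d[OF g2(2)]
        by (intro continuous_on_diff continuous_on_mult continuous_on_compose2[OF g1(4)[of UNIV]]
            continuous_on_compose2[OF g2(4)[of UNIV]] continuous_intros) auto
      from continuous_abs_le_sup_norm_on[OF this, of 0] pos show ?thesis by (auto simp: E_def)
    qed
    obtain f1' where f1': "C1_conformal_map f1 f1'" "\<forall>z\<in>cball 0 1. f1' z \<noteq> 0"
      "\<forall>\<theta>\<in>{0..2 * pi}. \<exists>a\<in>{0..L1}.
        norm (f1' (cis \<theta>)) = 1 / (2 * pi * \<phi>1 a) \<and> integral {0..a} \<phi>1 = \<theta> / (2 * pi)"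
      using conformal_map_profile[OF map(1) T(1) L12(1) \<phi>(1) assms(1,3) pos(1)] by blast
    obtain f2' where f2': "C1_conformal_map f2 f2'" "\<forall>z\<in>cball 0 1. f2' z \<noteq> 0"
      "\<forall>\<theta>\<in>{0..2 * pi}. \<exists>a\<in>{0..L2}.
        norm (f2' (cis \<theta>)) = 1 / (2 * pi * \<phi>2 a) \<and> integral {0..a} \<phi>2 = \<theta> / (2 * pi)"
      using conformal_map_profile[OF map(2) T(2) L12(2) \<phi>(2) assms(1,3) pos(2)] by blast
    \<comment> \<open>Profiles that are at least \<open>m\<close> and differ by at most
      \<open>C * \<delta>\<close> have ratio at most
      \<open>1 + C * \<delta> / m \<le> exp \<epsilon>\<close>.\<close>
    define \<epsilon> where "\<epsilon> = C * \<delta> / m"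
    have boundary: "norm (f1' z) \<le> R \<and> norm (f2' z) \<le> R \<and>
        norm (f1' z) \<le> exp \<epsilon> * norm (f2' z) \<and> norm (f2' z) \<le> exp \<epsilon> * norm (f1' z)"
      if z: "norm z = 1" for z
    proof -
      obtain \<theta> where \<theta>: "\<theta> \<in> {0..2 * pi}" "z = cis \<theta>" using unit_circle_cis[OF z] by blast
      obtain a where a: "a \<in> {0..L1}" "norm (f1' z) = 1 / (2 * pi * \<phi>1 a)" "integral {0..a} \<phi>1 = \<theta> / (2 * pi)"
        using bspec[OF f1'(3) \<theta>(1)] \<theta>(2) by blast
      obtain b where b: "b \<in> {0..L2}" "norm (f2' z) = 1 / (2 * pi * \<phi>2 b)" "integral {0..b} \<phi>2 = \<theta> / (2 * pi)"
        using bspec[OF f2'(3) \<theta>(1)] \<theta>(2) by blast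
      have "\<bar>\<phi>1 a - \<phi>2 b\<bar> \<le> C * \<delta>"
        unfolding C_def \<delta>_def
      \<comment> \<open>The primitives are the integrals of the profiles from \<open>0\<close>, and
        \<open>\<kappa>\<close> is their common value at \<open>a\<close> and
        \<open>b\<close>.\<close>
      proof (rule profile_comparison[OF integral_has_real_derivative[OF g1(3)]
            integral_has_real_derivative[OF g2(3)], where L = L and \<kappa> = "\<theta> / (2 * pi)"])
        show "\<bar>\<phi>1 x - \<phi>1 y\<bar> \<le> M1 * \<bar>x - y\<bar>" if "x \<in> {0..L1}" "y \<in> {0..L1}" for x y
          using field_differentiable_bound[of "{0..L1}" \<phi>1 "deriv \<phi>1" M1 x y] that g1(2,6)
          by (auto intro: has_field_derivative_at_within)
        show "0 \<le> \<theta> / (2 * pi)" "\<theta> / (2 * pi) \<le> 1" using \<theta>(1) by auto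
        show "0 \<le> M1" using assms by simp
        show "m \<le> \<phi>1 x" for x by (rule g1(1))
        show "\<bar>\<phi>1 (L1 / L * x) - \<phi>2 (L2 / L * x)\<bar> \<le> D" if "x \<in> {0..L}" for x
          using that by (rule D)
      qed (use a b assms L12(3-6) L in auto)
      moreover have ratio: "y \<le> exp \<epsilon> * x" if "\<bar>x - y\<bar> \<le> C * \<delta>" "m \<le> x" for x y
      proof -
        have "C * \<delta> \<le> \<epsilon> * x"
          using mult_left_mono[OF that(2), of "C * \<delta> / m"] C \<delta> assms by (simp add: \<epsilon>_def)
        with that have "y \<le> (1 + \<epsilon>) * x" by (simp add: algebra_simps)
        also have "\<dots> \<le> exp \<epsilon> * x"
          using that assms by (intro mult_right_mono exp_ge_add_one_self) auto
        finally show ?thesis .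
      qed
      ultimately have "\<phi>2 b \<le> exp \<epsilon> * \<phi>1 a" "\<phi>1 a \<le> exp \<epsilon> * \<phi>2 b"
        using g1(1)[of a] g2(1)[of b] by (auto simp: abs_minus_commute)
      moreover have "0 < \<phi>1 a" "0 < \<phi>2 b" using g1(1)[of a] g2(1)[of b] assms by linarith+
      ultimately show ?thesis
        unfolding a b R_def using g1(1)[of a] g2(1)[of b] assms by (auto simp: field_simps)
    qed
    have data: "f1 ` ball 0 1 = \<Omega>1" "f1 0 = \<zeta>\<^sub>o" "f2 ` ball 0 1 = \<Omega>2" "f2 0 = \<zeta>\<^sub>o"
      using map by (auto simp: is_conformal_map_def)
    note C1 = C1_conformal_map.deriv[OF f1'(1)] C1_conformal_map.deriv[OF f2'(1)]
      C1_conformal_map.cont_deriv[OF f1'(1)] C1_conformal_map.cont_deriv[OF f2'(1)]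
    obtain \<beta> where \<beta>: "\<And>z. z \<in> ball 0 1 \<Longrightarrow> norm (rotate_about \<zeta>\<^sub>o \<beta> (f1 z) - f2 z) \<le> 33 * R * \<epsilon>"
      using conformal_distance_le[OF C1 f1'(2)[rule_format] f2'(2)[rule_format] _ _ _ _ data(2,4),
          of R \<epsilon>] boundary by blast
    \<comment> \<open>Both domains are parametrized by the disc, so that equal parameters pair up
      nearby points.\<close>
    have "hausdorff_dist (rotate_about \<zeta>\<^sub>o \<beta> ` \<Omega>1) \<Omega>2
        = hausdorff_dist ((\<lambda>z. rotate_about \<zeta>\<^sub>o \<beta> (f1 z)) ` ball 0 1) (f2 ` ball 0 1)"
      by (simp add: data(3) image_image flip: data(1))
    also have "\<dots> \<le> 33 * R * \<epsilon>"
      by (rule hausdorff_dist_image_le) (use \<beta> in \<open>auto simp: dist_norm\<close>)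
    also have "\<dots> = 33 * R * (C / m) * \<delta>" by (simp add: \<epsilon>_def)
    \<comment> \<open>The linear bound is traded for the exponent \<open>\<alpha>\<close>, using
      \<open>\<delta> \<le> 2 * M1 + P\<close>.\<close>
    also have "\<dots> \<le> 33 * R * (C / m) * ((2 * M1 + P) powr (1 - \<alpha>) * \<delta> powr \<alpha>)"
      using \<delta> C R assms by (intro mult_left_mono le_powr_of_bounded) auto
    also have "\<dots> = K * \<delta> powr \<alpha>" by (simp add: K_def)
    also have "\<dots> \<le> K * (\<delta> powr \<alpha> + E)"
      using K \<open>0 \<le> E\<close> by (intro mult_left_mono) auto
    finally show "\<exists>\<beta>. hausdorff_dist (rotate_about \<zeta>\<^sub>o \<beta> ` \<Omega>1) \<Omega>2
        \<le> K * ((sup_norm_on {0..L} (\<lambda>s. \<psi>1 s - \<psi>2 s) + \<bar>L1 - L2\<bar>) powr \<alpha>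
                + sup_norm_on {0..L} (\<lambda>s. deriv \<psi>2 s - deriv \<psi>1 s))"
      unfolding \<delta>_def D_def E_def by blast
  qed
qed

end
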